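(* Let $n\ge3$. Let $(X,g)$ be an $n$-dimensional smooth connected Riemannian manifold without boundary, and let $Y_1,Y_2\subset X$ be $n$-dimensional compact connected $C^0$-submanifolds with nonempty boundaries $\partial Y_1$ and $\partial Y_2$ satisfying conditions (i) and (ii). Assume that $Y_1$ has property $(\circ)$ and that $X$ satisfies the following condition: $\rho_X(x,y)=\rho_Y(x,y)$ for any two points $x$ and $y$ on the boundary $\partial Y$ of every $n$-dimensional compact connected $C^0$-submanifold $Y\subset X$ with $\partial Y\neq\varnothing$ satisfying (i), (ii) and $(\circ)$. Suppose also that $\partial Y_1$ and $\partial Y_2$ are isometric in the metrics $\rho_{Y_j}$, $j=1,2$. Then $\partial Y_1$ and $\partial Y_2$ are isometric in $\rho_X$.
   Context: $\rho_X(x,y)$ is the intrinsic metric of $X$: the infimum of the Riemannian lengths of smooth paths in $X$ joining $x$ and $y$. An $n$-dimensional $C^0$-submanifold $Y$ with boundary of an $n$-dimensional manifold $X$ is a subset which is an $n$-dimensional topological manifold with boundary in the induced topology; $\partial Y$ is its boundary and $\mathrm{Int}\,Y=Y\setminus\partial Y$ its interior. Conditions on $Y$: (i) for all $x,y\in Y$, $$\rho_Y(x,y)=\liminf_{x'\to x,\;y'\to y;\;x',y'\in\mathrm{Int}\,Y}\{\inf[l(\gamma_{x',y',\mathrm{Int}\,Y})]\}<\infty,$$ where the infimum is over the Riemannian lengths of smooth paths $\gamma_{x',y',\mathrm{Int}\,Y}:[0,1]\to\mathrm{Int}\,Y$ joining $x'$ and $y'$ in $\mathrm{Int}\,Y$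 (this formula also defines $\rho_Y$); (ii) $\rho_Y$ is a metric on $Y$. A shortest path in the metric $\rho_Y$ between distinct points $x,y\in Y$ is a path $\gamma:[0,1]\to Y$ with $\gamma(0)=x$, $\gamma(1)=y$ and $\rho_Y(\gamma(s),\gamma(t))=(t-s)\rho_Y(x,y)$ for $0\le s<t\le1$. Paths are continuous and non-constant. $Y$ has property $(\circ)$ if, for any two points $x,y\in\partial Y$ and every shortest path $\gamma:[0,1]\to Y$ in the metric $\rho_Y$ joining them, $\gamma(]0,1[)\subset\mathrm{Int}\,Y$. $\partial Y_1$ and $\partial Y_2$ are isometric in the metrics $\rho_{Y_j}$ if there is a surjective map $f:\partial Y_1\to\partial Y_2$ with $\rho_{Y_2}(f(x),f(y))=\rho_{Y_1}(x,y)$ for all $x,y\in\partial Y_1$; they are isometric in $\rho_X$ if there is a surjective map $f:\partial Y_1\to\partial Y_2$ with $\rho_X(f(x),f(y))=\rho_X(x,y)$ for all $x,y\in\partial Y_1$. *)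

theory Defs
  imports "HOL-Analysis.Analysis"
begin

text \<open>For open S this is the usual class of k times continuously differentiable functions:
  all iterated directional derivatives are required to exist and to be continuous.\<close>

primrec Ck_on :: "nat \<Rightarrow> 'a::euclidean_space set \<Rightarrow> ('a \<Rightarrow> 'b::euclidean_space) \<Rightarrow> bool" where
  "Ck_on 0 S f \<longleftrightarrow> continuous_on S f"
| "Ck_on (Suc k) S f \<longleftrightarrow>
     (\<forall>x\<in>S. f differentiable (at x)) \<and> (\<forall>v. Ck_on k S (\<lambda>x. frechet_derivative f (at x) v))"

text \<open>Smoothness on an arbitrary subset (used for open sets and for relatively open subsets of
  the interval [0,1]): locally there is a smooth extension to an open set.\<close>

definition smooth_on :: "'a::euclidean_space set \<Rightarrow> ('a \<Rightarrow> 'b::euclidean_space) \<Rightarrow> bool" where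
  "smooth_on S f \<longleftrightarrow>
     (\<forall>x\<in>S. \<exists>N F. open N \<and> x \<in> N \<and> (\<forall>k. Ck_on k N F) \<and> (\<forall>y\<in>N \<inter> S. F y = f y))"

text \<open>A chart is a pair consisting of its domain and its coordinate map; the values of the
  coordinate map outside the domain are irrelevant. The dimension is the cardinality of the
  index type.\<close>

type_synonym ('a, 'n) chart = "'a set \<times> ('a \<Rightarrow> real ^ 'n)"

definition chart_on :: "'a topology \<Rightarrow> ('a, 'n::finite) chart \<Rightarrow> bool" where
  "chart_on X c \<longleftrightarrow>
     openin X (fst c) \<and> open (snd c ` fst c) \<and>
     homeomorphic_map (subtopology X (fst c)) (top_of_set (snd c ` fst c)) (snd c)"

definition transition :: "('a, 'n::finite) chart \<Rightarrow> ('a, 'n) chart \<Rightarrow> real ^ 'n \<Rightarrow> real ^ 'n" where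
  "transition c c' = snd c' \<circ> inv_into (fst c) (snd c)"

text \<open>The atlas need not be maximal: any smooth atlas determines the smooth structure.\<close>

definition smooth_manifold :: "'a topology \<Rightarrow> ('a, 'n::finite) chart set \<Rightarrow> bool" where
  "smooth_manifold X A \<longleftrightarrow>
     Hausdorff_space X \<and> second_countable X \<and>
     (\<forall>c\<in>A. chart_on X c) \<and> topspace X = (\<Union>c\<in>A. fst c) \<and>
     (\<forall>c\<in>A. \<forall>c'\<in>A. smooth_on (snd c ` (fst c \<inter> fst c')) (transition c c'))"

text \<open>A Riemannian metric is given by its coordinate representations: g c p is the inner product
  on the tangent space at p, written in the coordinates of the chart c. The last clause is the
  transformation law under change of chart.\<close>

type_synonym ('a, 'n) metric_field =
  "('a, 'n) chart \<Rightarrow> 'a \<Rightarrow> real ^ 'n \<Rightarrow> real ^ 'n \<Rightarrow> real"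

definition riemannian_metric ::
    "('a, 'n::finite) chart set \<Rightarrow> ('a, 'n) metric_field \<Rightarrow> bool" where
  "riemannian_metric A g \<longleftrightarrow>
     (\<forall>c\<in>A. \<forall>p\<in>fst c.
        bilinear (g c p) \<and> (\<forall>u v. g c p u v = g c p v u) \<and> (\<forall>u. u \<noteq> 0 \<longrightarrow> g c p u u > 0)) \<and>
     (\<forall>c\<in>A. \<forall>u v. smooth_on (snd c ` fst c) (\<lambda>x. g c (inv_into (fst c) (snd c) x) u v)) \<and>
     (\<forall>c\<in>A. \<forall>c'\<in>A. \<forall>p\<in>fst c \<inter> fst c'. \<forall>u v.
        g c p u v = g c' p (frechet_derivative (transition c c') (at (snd c p)) u)
                           (frechet_derivative (transition c c') (at (snd c p)) v))"

definition riemannian_manifold ::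
    "'a topology \<Rightarrow> ('a, 'n::finite) chart set \<Rightarrow> ('a, 'n) metric_field \<Rightarrow> bool" where
  "riemannian_manifold X A g \<longleftrightarrow> smooth_manifold X A \<and> riemannian_metric A g"

text \<open>Paths are parametrised by [0,1] and are non-constant by convention.\<close>

definition path_within :: "'a topology \<Rightarrow> 'a set \<Rightarrow> (real \<Rightarrow> 'a) \<Rightarrow> bool" where
  "path_within X S \<gamma> \<longleftrightarrow> pathin (subtopology X S) \<gamma> \<and> \<not> \<gamma> constant_on {0..1}"

definition smooth_path_within ::
    "'a topology \<Rightarrow> ('a, 'n::finite) chart set \<Rightarrow> 'a set \<Rightarrow> (real \<Rightarrow> 'a) \<Rightarrow> bool" where
  "smooth_path_within X A S \<gamma> \<longleftrightarrow>
     path_within X S \<gamma> \<and> (\<forall>c\<in>A. smooth_on {t \<in> {0..1}. \<gamma> t \<in> fst c} (snd c \<circ> \<gamma>))"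

text \<open>The choice of the chart around the point is immaterial, by the transformation law of the
  metric.\<close>

definition speed ::
    "('a, 'n::finite) chart set \<Rightarrow> ('a, 'n) metric_field \<Rightarrow> (real \<Rightarrow> 'a) \<Rightarrow> real \<Rightarrow> real" where
  "speed A g \<gamma> t =
     (let c = (SOME c. c \<in> A \<and> \<gamma> t \<in> fst c);
          v = vector_derivative (snd c \<circ> \<gamma>) (at t within {0..1})
      in sqrt (g c (\<gamma> t) v v))"

definition riem_length ::
    "('a, 'n::finite) chart set \<Rightarrow> ('a, 'n) metric_field \<Rightarrow> (real \<Rightarrow> 'a) \<Rightarrow> real" where
  "riem_length A g \<gamma> = integral {0..1} (speed A g \<gamma>)"

text \<open>Distances take values in the extended non-negative reals; the distance is infinite if no
  smooth path joins the two points.\<close>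

definition path_dist ::
    "'a topology \<Rightarrow> ('a, 'n::finite) chart set \<Rightarrow> ('a, 'n) metric_field \<Rightarrow> 'a set \<Rightarrow> 'a \<Rightarrow> 'a \<Rightarrow> ennreal"
  where
  "path_dist X A g S x y =
     Inf {ennreal (riem_length A g \<gamma>) | \<gamma>. smooth_path_within X A S \<gamma> \<and> \<gamma> 0 = x \<and> \<gamma> 1 = y}"

definition rho_X ::
    "'a topology \<Rightarrow> ('a, 'n::finite) chart set \<Rightarrow> ('a, 'n) metric_field \<Rightarrow> 'a \<Rightarrow> 'a \<Rightarrow> ennreal" where
  "rho_X X A g = path_dist X A g (topspace X)"

text \<open>The argument of type itself only records the dimension.\<close>

definition half_space :: "(real ^ 'n::finite) set" where
  "half_space = {x. 0 \<le> x $ (SOME i. True)}"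

definition half_space_hyperplane :: "(real ^ 'n::finite) set" where
  "half_space_hyperplane = {x. x $ (SOME i. True) = 0}"

definition half_space_chart :: "'a topology \<Rightarrow> ('a, 'n::finite) chart \<Rightarrow> bool" where
  "half_space_chart T c \<longleftrightarrow>
     openin T (fst c) \<and> openin (top_of_set half_space) (snd c ` fst c) \<and>
     homeomorphic_map (subtopology T (fst c)) (top_of_set (snd c ` fst c)) (snd c)"

definition manifold_with_boundary :: "'n::finite itself \<Rightarrow> 'a topology \<Rightarrow> bool" where
  "manifold_with_boundary _ T \<longleftrightarrow>
     Hausdorff_space T \<and> second_countable T \<and>
     (\<forall>p\<in>topspace T. \<exists>c :: ('a, 'n) chart. half_space_chart T c \<and> p \<in> fst c)"

definition mfd_boundary :: "'n::finite itself \<Rightarrow> 'a topology \<Rightarrow> 'a set" where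
  "mfd_boundary _ T =
     {p. \<exists>c :: ('a, 'n) chart.
           half_space_chart T c \<and> p \<in> fst c \<and> snd c p \<in> half_space_hyperplane}"

definition C0_submanifold :: "'n::finite itself \<Rightarrow> 'a topology \<Rightarrow> 'a set \<Rightarrow> bool" where
  "C0_submanifold d X Y \<longleftrightarrow> Y \<subseteq> topspace X \<and> manifold_with_boundary d (subtopology X Y)"

text \<open>The boundary and interior of Y as a manifold, not relative to the ambient space X.\<close>

definition bdry :: "'n::finite itself \<Rightarrow> 'a topology \<Rightarrow> 'a set \<Rightarrow> 'a set" where
  "bdry d X Y = mfd_boundary d (subtopology X Y)"

definition intr :: "'n::finite itself \<Rightarrow> 'a topology \<Rightarrow> 'a set \<Rightarrow> 'a set" where
  "intr d X Y = Y - bdry d X Y"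

text \<open>In the lower limit, x' and y' range over all points of the interior close to x and y,
  including x and y themselves when these are interior points.\<close>

definition rho_Y ::
    "'a topology \<Rightarrow> ('a, 'n::finite) chart set \<Rightarrow> ('a, 'n) metric_field \<Rightarrow> 'a set \<Rightarrow> 'a \<Rightarrow> 'a \<Rightarrow> ennreal"
  where
  "rho_Y X A g Y x y =
     (let I = intr TYPE('n) X Y
      in Liminf (inf (nhdsin X x) (principal I) \<times>\<^sub>F inf (nhdsin X y) (principal I))
           (\<lambda>(x', y'). path_dist X A g I x' y'))"

definition cond_i ::
    "'a topology \<Rightarrow> ('a, 'n::finite) chart set \<Rightarrow> ('a, 'n) metric_field \<Rightarrow> 'a set \<Rightarrow> bool" where
  "cond_i X A g Y \<longleftrightarrow> (\<forall>x\<in>Y. \<forall>y\<in>Y. rho_Y X A g Y x y < \<infinity>)"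

text \<open>The library's notion of metric is real-valued, hence the conversion, which is faithful
  under the finiteness condition above. The library also demands symmetry off Y; this
  holds for every Y, since smooth paths can be reversed.\<close>

definition cond_ii ::
    "'a topology \<Rightarrow> ('a, 'n::finite) chart set \<Rightarrow> ('a, 'n) metric_field \<Rightarrow> 'a set \<Rightarrow> bool" where
  "cond_ii X A g Y \<longleftrightarrow> Metric_space Y (\<lambda>x y. enn2real (rho_Y X A g Y x y))"

definition shortest_path ::
    "'a topology \<Rightarrow> ('a, 'n::finite) chart set \<Rightarrow> ('a, 'n) metric_field \<Rightarrow> 'a set \<Rightarrow>
      'a \<Rightarrow> 'a \<Rightarrow> (real \<Rightarrow> 'a) \<Rightarrow> bool" where
  "shortest_path X A g Y x y \<gamma> \<longleftrightarrow>
     x \<noteq> y \<and> path_within X Y \<gamma> \<and> \<gamma> 0 = x \<and> \<gamma> 1 = y \<and>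
     (\<forall>s t. 0 \<le> s \<and> s < t \<and> t \<le> 1 \<longrightarrow>
        rho_Y X A g Y (\<gamma> s) (\<gamma> t) = ennreal (t - s) * rho_Y X A g Y x y)"

definition circ_property ::
    "'a topology \<Rightarrow> ('a, 'n::finite) chart set \<Rightarrow> ('a, 'n) metric_field \<Rightarrow> 'a set \<Rightarrow> bool" where
  "circ_property X A g Y \<longleftrightarrow>
     (\<forall>x\<in>bdry TYPE('n) X Y. \<forall>y\<in>bdry TYPE('n) X Y. \<forall>\<gamma>.
        shortest_path X A g Y x y \<gamma> \<longrightarrow> \<gamma> ` {0<..<1} \<subseteq> intr TYPE('n) X Y)"

definition admissible ::
    "'a topology \<Rightarrow> ('a, 'n::finite) chart set \<Rightarrow> ('a, 'n) metric_field \<Rightarrow> 'a set \<Rightarrow> bool" where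
  "admissible X A g Y \<longleftrightarrow>
     C0_submanifold TYPE('n) X Y \<and> compactin X Y \<and> connectedin X Y \<and>
     bdry TYPE('n) X Y \<noteq> {} \<and> cond_i X A g Y \<and> cond_ii X A g Y"

definition isometric ::
    "'a set \<Rightarrow> ('a \<Rightarrow> 'a \<Rightarrow> ennreal) \<Rightarrow> 'b set \<Rightarrow> ('b \<Rightarrow> 'b \<Rightarrow> ennreal) \<Rightarrow> bool" where
  "isometric S d S' d' \<longleftrightarrow> (\<exists>f. f ` S = S' \<and> (\<forall>x\<in>S. \<forall>y\<in>S. d' (f x) (f y) = d x y))"

end

theory Submission
  imports Defs
begin

text \<open>
  On the boundary of \<open>Y1\<close> the metrics \<open>rho_X\<close> and \<open>rho_Y\<close> agree by the assumption on
  \<open>X\<close>. The theorem follows as soon as they agree on the boundary of \<open>Y2\<close> too, since the given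
  boundary isometry then preserves \<open>rho_X\<close>; and for this it suffices that \<open>Y2\<close> has the property
  that shortest paths between boundary points have their interior in the interior of the manifold.

  This property can be read off from the distances between boundary points alone, and is therefore
  carried over by the isometry: it holds iff the triangle inequality is strict for any three distinct
  boundary points \<open>x\<close>, \<open>z\<close>, \<open>y\<close>. If a shortest path from \<open>x\<close> to \<open>y\<close> meets the boundary at
  \<open>z\<close>, the distances add up (\<open>circ_propertyI\<close>). Conversely, if they add up, shortest paths from
  \<open>x\<close> to \<open>z\<close> and from \<open>z\<close> to \<open>y\<close> fit together to a shortest path through \<open>z\<close>
  (\<open>circ_property_strict_triangle\<close>).

  The converse needs the existence of shortest paths (\<open>shortest_path_exists\<close>). Interior points near
  the two endpoints are joined by smooth interior paths whose lengths approximate the distance. These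
  paths, run through proportionally to arc length, are points of a product of copies of the compact
  space \<open>Y\<close>, and so have a cluster point \<open>\<gamma>\<close>. As \<open>rho_Y\<close> is a lower limit of distances in the
  interior, the Lipschitz bound of the approximating paths survives in the limit, and by the triangle
  inequality it must be an equality for \<open>\<gamma>\<close>. A Lipschitz bound with respect to \<open>rho_Y\<close> gives
  continuity in the topology of \<open>X\<close>, because a path that starts near a point and leaves a
  neighbourhood of it cannot be arbitrarily short (\<open>short_paths_stay_near\<close>).
\<close>

section \<open>Smooth functions of a real variable\<close>

lemma Ck_on_cong:
  assumes "open S" "\<And>x. x \<in> S \<Longrightarrow> f x = h x" "Ck_on k S f"
  shows "Ck_on k S h"
  using assms(2,3)
proof (induction k arbitrary: f h)
  case 0
  then show ?case by (simp cong: continuous_on_cong)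
next
  case (Suc k)
  have der: "(h has_derivative frechet_derivative f (at x)) (at x)" if "x \<in> S" for x
    using has_derivative_transform_within_open[OF _ assms(1) that Suc.prems(1)] Suc.prems(2) that
    by (auto simp: frechet_derivative_works)
  have "Ck_on k S (\<lambda>x. frechet_derivative h (at x) v)" for v
  proof (rule Suc.IH)
    show "Ck_on k S (\<lambda>x. frechet_derivative f (at x) v)"
      using Suc.prems by simp
    show "frechet_derivative f (at x) v = frechet_derivative h (at x) v" if "x \<in> S" for x
      using frechet_derivative_at[OF der[OF that]] by simp
  qed
  with der show ?case by (auto intro: differentiableI)
qed

lemma Ck_on_affine_compose:
  fixes f :: "real \<Rightarrow> 'b::euclidean_space" and a b :: real
  assumes "open N" "Ck_on k N f"
  shows "Ck_on k ((\<lambda>u. a + b * u) -` N) (\<lambda>u. f (a + b * u))"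
  using assms(2)
proof (induction k arbitrary: f)
  case 0
  then show ?case
    by (auto intro!: continuous_on_compose2[of N f] continuous_intros)
next
  case (Suc k)
  let ?M = "(\<lambda>u. a + b * u) -` N"
  have opn: "open ?M"
    by (intro open_vimage assms(1) continuous_intros)
  have der: "((\<lambda>u. f (a + b * u)) has_derivative
      (\<lambda>v. frechet_derivative f (at (a + b * u)) (b * v))) (at u)" if "u \<in> ?M" for u
  proof -
    have "((\<lambda>u. a + b * u) has_derivative (\<lambda>v. b * v)) (at u)"
      by (auto intro!: derivative_eq_intros)
    moreover have "(f has_derivative frechet_derivative f (at (a + b * u))) (at (a + b * u))"
      using Suc.prems that by (simp add: frechet_derivative_works)
    ultimately show ?thesis
      by (rule has_derivative_compose)
  qed
  have "Ck_on k ?M (\<lambda>u. frechet_derivative (\<lambda>u. f (a + b * u)) (at u) v)" for v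
  proof (rule Ck_on_cong[OF opn])
    show "Ck_on k ?M (\<lambda>u. frechet_derivative f (at (a + b * u)) (b * v))"
      using Suc.prems by (intro Suc.IH) simp
    show "frechet_derivative f (at (a + b * u)) (b * v)
        = frechet_derivative (\<lambda>u. f (a + b * u)) (at u) v" if "u \<in> ?M" for u
      using frechet_derivative_at[OF der[OF that]] by metis
  qed
  with der show ?case by (auto intro: differentiableI)
qed

lemma Ck_on_vector_derivative:
  fixes F :: "real \<Rightarrow> 'b::euclidean_space"
  assumes "Ck_on (Suc 0) N F"
  shows "\<And>s. s \<in> N \<Longrightarrow> (F has_vector_derivative frechet_derivative F (at s) 1) (at s)"
    and "continuous_on N (\<lambda>s. frechet_derivative F (at s) 1)"
proof -
  show "(F has_vector_derivative frechet_derivative F (at s) 1) (at s)" if "s \<in> N" for s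
  proof -
    have d: "(F has_derivative frechet_derivative F (at s)) (at s)"
      using assms that by (simp add: frechet_derivative_works)
    have "frechet_derivative F (at s) r = r *\<^sub>R frechet_derivative F (at s) 1" for r
      using linear_cmul[OF has_derivative_linear[OF d], of r 1] by simp
    then have eq: "frechet_derivative F (at s) = (\<lambda>r. r *\<^sub>R frechet_derivative F (at s) 1)"
      by (rule ext)
    show ?thesis
      unfolding has_vector_derivative_def by (rule subst[OF eq, of "\<lambda>f. (F has_derivative f) (at s)", OF d])
  qed
  show "continuous_on N (\<lambda>s. frechet_derivative F (at s) 1)"
    using assms by simp
qed

lemma smooth_on_affine_compose:
  fixes f :: "real \<Rightarrow> 'b::euclidean_space"
  assumes "smooth_on S f" "\<And>u. u \<in> T \<Longrightarrow> a + b * u \<in> S"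
  shows "smooth_on T (\<lambda>u. f (a + b * u))"
  unfolding smooth_on_def
proof
  fix u assume "u \<in> T"
  with assms obtain N F where NF: "open N" "a + b * u \<in> N" "\<forall>k. Ck_on k N F" "\<forall>y\<in>N \<inter> S. F y = f y"
    unfolding smooth_on_def by meson
  let ?M = "(\<lambda>u. a + b * u) -` N"
  have "open ?M"
    by (intro open_vimage NF(1) continuous_intros)
  moreover have "\<forall>k. Ck_on k ?M (\<lambda>u. F (a + b * u))"
    using NF(1,3) Ck_on_affine_compose by blast
  ultimately show "\<exists>N F. open N \<and> u \<in> N \<and> (\<forall>k. Ck_on k N F) \<and> (\<forall>y\<in>N \<inter> T. F y = f (a + b * y))"
    using NF(2,4) assms(2) by (intro exI[of _ ?M] exI[of _ "\<lambda>u. F (a + b * u)"]) auto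
qed

section \<open>Charts and the speed of a smooth path\<close>

locale riemannian =
  fixes X :: "'a topology" and A :: "('a, 'n::finite) chart set" and g :: "('a, 'n) metric_field"
  assumes riemannian: "riemannian_manifold X A g"
begin

lemma smooth_manifold: "smooth_manifold X A"
  and riemannian_metric: "riemannian_metric A g"
  using riemannian by (auto simp: riemannian_manifold_def)

lemma Hausdorff: "Hausdorff_space X"
  and chart: "c \<in> A \<Longrightarrow> chart_on X c"
  and atlas_covers: "p \<in> topspace X \<Longrightarrow> \<exists>c\<in>A. p \<in> fst c"
  and smooth_transition:
    "c \<in> A \<Longrightarrow> c' \<in> A \<Longrightarrow> smooth_on (snd c ` (fst c \<inter> fst c')) (transition c c')"
  using smooth_manifold by (simp_all add: smooth_manifold_def)

lemmas riemannian_metric_parts = riemannian_metric[unfolded riemannian_metric_def]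

lemma bilinear_metric: "c \<in> A \<Longrightarrow> p \<in> fst c \<Longrightarrow> bilinear (g c p)"
  and metric_pos: "c \<in> A \<Longrightarrow> p \<in> fst c \<Longrightarrow> u \<noteq> 0 \<Longrightarrow> g c p u u > 0"
  using riemannian_metric_parts[THEN conjunct1] by blast+

lemma smooth_metric:
  "c \<in> A \<Longrightarrow> smooth_on (snd c ` fst c) (\<lambda>x. g c (inv_into (fst c) (snd c) x) u v)"
  using riemannian_metric_parts[THEN conjunct2, THEN conjunct1] by blast

lemma metric_transform:
  "c \<in> A \<Longrightarrow> c' \<in> A \<Longrightarrow> p \<in> fst c \<inter> fst c' \<Longrightarrow>
   g c p u v = g c' p (frechet_derivative (transition c c') (at (snd c p)) u)
                      (frechet_derivative (transition c c') (at (snd c p)) v)"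
  by (rule riemannian_metric_parts[THEN conjunct2, THEN conjunct2, rule_format])

lemma chart_facts:
  assumes "c \<in> A"
  shows chart_openin: "openin X (fst c)" and chart_subset: "fst c \<subseteq> topspace X"
    and chart_open_image: "open (snd c ` fst c)" and chart_inj: "inj_on (snd c) (fst c)"
    and chart_homeomorphic: "homeomorphic_map (subtopology X (fst c)) (top_of_set (snd c ` fst c)) (snd c)"
    and chart_continuous: "continuous_map (subtopology X (fst c)) euclidean (snd c)"
proof -
  note c = chart[OF assms, unfolded chart_on_def]
  show o: "openin X (fst c)" and "open (snd c ` fst c)"
    and h: "homeomorphic_map (subtopology X (fst c)) (top_of_set (snd c ` fst c)) (snd c)"
    using c by auto
  show sub: "fst c \<subseteq> topspace X"
    using o by (rule openin_subset)
  show "inj_on (snd c) (fst c)"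
    using homeomorphic_imp_injective_map[OF h] sub by (simp add: inf.absorb2)
  show "continuous_map (subtopology X (fst c)) euclidean (snd c)"
    using homeomorphic_imp_continuous_map[OF h] by (simp add: continuous_map_in_subtopology)
qed

lemma chart_inv_into [simp]: "c \<in> A \<Longrightarrow> p \<in> fst c \<Longrightarrow> inv_into (fst c) (snd c) (snd c p) = p"
  by (simp add: chart_inj)

lemma open_chart_image:
  assumes "c \<in> A" "openin X U" "U \<subseteq> fst c"
  shows "open (snd c ` U)"
proof -
  have "openin (subtopology X (fst c)) U"
    using assms by (auto simp: openin_subtopology)
  then have "openin (top_of_set (snd c ` fst c)) (snd c ` U)"
    using homeomorphic_imp_open_map[OF chart_homeomorphic[OF assms(1)]] by (auto simp: open_map_def)
  then show ?thesis
    using chart_open_image[OF assms(1)] openin_open_eq by blast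
qed

lemma openin_chart_preimage:
  assumes "c \<in> A" "open U"
  shows "openin X {p \<in> fst c. snd c p \<in> U}"
proof -
  have "openin (subtopology X (fst c)) {p \<in> topspace (subtopology X (fst c)). snd c p \<in> U}"
    using chart_continuous[OF assms(1)] assms(2) by (intro openin_continuous_map_preimage) auto
  moreover have "topspace (subtopology X (fst c)) = fst c"
    using chart_subset[OF assms(1)] by auto
  ultimately show ?thesis
    using chart_openin[OF assms(1)] openin_trans_full by fastforce
qed

lemma inverse_chart_continuous:
  assumes "c \<in> A"
  shows "continuous_map (top_of_set (snd c ` fst c)) X (inv_into (fst c) (snd c))"
proof -
  obtain k where k: "homeomorphic_maps (subtopology X (fst c)) (top_of_set (snd c ` fst c)) (snd c) k"
    using chart_homeomorphic[OF assms] homeomorphic_map_maps by blast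
  then have "continuous_map (top_of_set (snd c ` fst c)) X k"
    by (auto simp: homeomorphic_maps_def continuous_map_in_subtopology)
  moreover have "k y = inv_into (fst c) (snd c) y" if "y \<in> snd c ` fst c" for y
    using that k chart_subset[OF assms] assms by (auto simp: homeomorphic_maps_def)
  ultimately show ?thesis
    by (rule continuous_map_eq) auto
qed

lemma transition_differentiable:
  assumes "c \<in> A" "c' \<in> A" "p \<in> fst c" "p \<in> fst c'"
  shows "transition c c' differentiable (at (snd c p))"
proof -
  let ?U = "snd c ` (fst c \<inter> fst c')"
  obtain N F where N: "open N" "snd c p \<in> N" "\<forall>k. Ck_on k N F" "\<forall>y\<in>N \<inter> ?U. F y = transition c c' y"
    using smooth_transition[OF assms(1,2), unfolded smooth_on_def, rule_format, of "snd c p"] assms(3,4) by auto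
  have opn: "open (N \<inter> ?U)"
    using assms(1,2) by (intro open_Int N(1) open_chart_image openin_Int chart_openin) auto
  have "Ck_on (Suc 0) N F"
    using N(3) by blast
  then have "(F has_derivative frechet_derivative F (at (snd c p))) (at (snd c p))"
    using N(2) by (simp add: frechet_derivative_works)
  then have "(transition c c' has_derivative frechet_derivative F (at (snd c p))) (at (snd c p))"
    by (rule has_derivative_transform_within_open[OF _ opn]) (use N assms in auto)
  then show ?thesis
    by (rule differentiableI)
qed

text \<open>Smoothness of the metric is stated for fixed vectors; expanding in the standard
  basis gives continuity jointly in the point and the vector.\<close>

lemma metric_expand:
  assumes "c \<in> A" "p \<in> fst c"
  shows "g c p v v = (\<Sum>(i,j)\<in>UNIV. (v $ i * v $ j) * g c p (axis i 1) (axis j 1))"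
proof -
  interpret bl: bounded_bilinear "g c p"
    using bilinear_metric[OF assms] by (simp only: bilinear_conv_bounded_bilinear)
  have "(\<Sum>i\<in>UNIV. v $ i *\<^sub>R axis i 1) = v"
    using basis_expansion[of v] by (simp only: scalar_mult_eq_scaleR)
  then have "g c p v v = g c p (\<Sum>i\<in>UNIV. v $ i *\<^sub>R axis i 1) (\<Sum>j\<in>UNIV. v $ j *\<^sub>R axis j 1)"
    by (simp only:)
  also have "\<dots> = (\<Sum>(i,j)\<in>UNIV \<times> UNIV. g c p (v $ i *\<^sub>R axis i 1) (v $ j *\<^sub>R axis j 1))"
    by (rule bilinear_sum[OF bilinear_metric[OF assms]])
  also have "\<dots> = (\<Sum>(i,j)\<in>UNIV. (v $ i * v $ j) * g c p (axis i 1) (axis j 1))"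
    by (simp add: bl.scaleR_left bl.scaleR_right mult.assoc mult.left_commute)
  finally show ?thesis .
qed

lemma metric_coefficient_continuous:
  assumes "c \<in> A"
  shows "continuous_on (snd c ` fst c) (\<lambda>x. g c (inv_into (fst c) (snd c) x) u v)"
proof -
  let ?h = "\<lambda>x. g c (inv_into (fst c) (snd c) x) u v"
  have "isCont ?h x" if x: "x \<in> snd c ` fst c" for x
  proof -
    obtain N F where N: "open N" "x \<in> N" "\<forall>k. Ck_on k N F" "\<forall>y\<in>N \<inter> snd c ` fst c. F y = ?h y"
      using smooth_metric[OF assms] x unfolding smooth_on_def by meson
    have o: "open (N \<inter> snd c ` fst c)"
      by (intro open_Int N(1) chart_open_image assms)
    have "Ck_on 0 N F"
      using N(3) by blast
    then have "continuous_on (N \<inter> snd c ` fst c) F"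
      by (auto intro: continuous_on_subset)
    then have "continuous_on (N \<inter> snd c ` fst c) ?h"
      by (rule continuous_on_eq) (use N(4) in auto)
    with o x N(2) show ?thesis
      by (simp add: continuous_on_eq_continuous_at)
  qed
  then show ?thesis
    by (simp add: continuous_at_imp_continuous_on)
qed

lemma metric_continuous:
  assumes "c \<in> A" "continuous_on T \<xi>" "\<And>t. t \<in> T \<Longrightarrow> \<xi> t \<in> snd c ` fst c" "continuous_on T w"
  shows "continuous_on T (\<lambda>t. g c (inv_into (fst c) (snd c) (\<xi> t)) (w t) (w t))"
proof -
  have "continuous_on T (\<lambda>t. \<Sum>(i,j)\<in>UNIV. (w t $ i * w t $ j) *
      g c (inv_into (fst c) (snd c) (\<xi> t)) (axis i 1) (axis j 1))"
    unfolding case_prod_beta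
    using assms
    by (intro continuous_intros continuous_on_compose2[OF metric_coefficient_continuous[OF assms(1)]]) auto
  moreover have "g c (inv_into (fst c) (snd c) (\<xi> t)) (w t) (w t) = (\<Sum>(i,j)\<in>UNIV. (w t $ i * w t $ j) *
      g c (inv_into (fst c) (snd c) (\<xi> t)) (axis i 1) (axis j 1))" if "t \<in> T" for t
    using assms(3)[OF that] by (intro metric_expand assms(1)) (simp add: inv_into_into)
  ultimately show ?thesis
    by (simp cong: continuous_on_cong)
qed

lemma smooth_path_continuous:
  assumes "smooth_path_within X A S \<gamma>"
  shows "continuous_map (top_of_set {0..1}) X \<gamma>" and "\<gamma> ` {0..1} \<subseteq> topspace X"
    and "\<And>t. t \<in> {0..1} \<Longrightarrow> \<gamma> t \<in> S"
proof -
  have p: "continuous_map (top_of_set {0..1}) (subtopology X S) \<gamma>"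
    using assms by (simp add: smooth_path_within_def path_within_def pathin_def)
  then show c: "continuous_map (top_of_set {0..1}) X \<gamma>"
    by (simp add: continuous_map_in_subtopology)
  show "\<gamma> ` {0..1} \<subseteq> topspace X"
    using continuous_map_image_subset_topspace[OF c] by simp
  show "\<And>t. t \<in> {0..1} \<Longrightarrow> \<gamma> t \<in> S"
    using continuous_map_image_subset_topspace[OF p] by auto
qed

text \<open>Near each parameter, also at the two ends of the unit interval, the coordinate path has a smooth
  extension to an open interval; this yields a continuous velocity there.\<close>

lemma local_velocity:
  assumes \<gamma>: "smooth_path_within X A S \<gamma>" and c: "c \<in> A" and t: "t \<in> {0..1}" "\<gamma> t \<in> fst c"
  obtains N F' where "open N" "t \<in> N" "\<And>s. s \<in> N \<inter> {0..1} \<Longrightarrow> \<gamma> s \<in> fst c"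
    "\<And>s. s \<in> N \<inter> {0..1} \<Longrightarrow> ((snd c \<circ> \<gamma>) has_vector_derivative F' s) (at s within {0..1})"
    "continuous_on N F'"
proof -
  let ?T = "{t \<in> {0..1}. \<gamma> t \<in> fst c}"
  have "smooth_on ?T (snd c \<circ> \<gamma>)"
    using \<gamma> c by (simp add: smooth_path_within_def)
  then obtain N F where N: "open N" "t \<in> N" "\<forall>k. Ck_on k N F" "\<forall>y\<in>N \<inter> ?T. F y = (snd c \<circ> \<gamma>) y"
    using t unfolding smooth_on_def by (metis (no_types, lifting) mem_Collect_eq)
  have "openin (top_of_set {0..1}) ?T"
    using openin_continuous_map_preimage[OF smooth_path_continuous(1)[OF \<gamma>] chart_openin[OF c]] by simp
  then obtain M where M: "open M" "?T = {0..1} \<inter> M"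
    by (auto simp: openin_open)
  have C1: "Ck_on (Suc 0) N F"
    using N(3) by blast
  let ?F' = "\<lambda>s. frechet_derivative F (at s) 1"
  show ?thesis
  proof (rule that[of "N \<inter> M" ?F'])
    show "open (N \<inter> M)" "t \<in> N \<inter> M"
      using N M t by auto
    show inc: "\<gamma> s \<in> fst c" if "s \<in> (N \<inter> M) \<inter> {0..1}" for s
      using M(2) that by blast
    show "continuous_on (N \<inter> M) ?F'"
      using Ck_on_vector_derivative(2)[OF C1] by (auto intro: continuous_on_subset)
    show "((snd c \<circ> \<gamma>) has_vector_derivative ?F' s) (at s within {0..1})"
      if s: "s \<in> (N \<inter> M) \<inter> {0..1}" for s
    proof -
      have "open (N \<inter> M)" "s \<in> N \<inter> M"
        using s N(1) M(1) by auto
      then obtain e where e: "e > 0" "ball s e \<subseteq> N \<inter> M"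
        by (rule openE)
      have "(F has_vector_derivative ?F' s) (at s within {0..1})"
        by (rule has_vector_derivative_at_within[OF Ck_on_vector_derivative(1)[OF C1]]) (use s in blast)
      then show ?thesis
      proof (rule has_vector_derivative_transform_within[OF _ e(1)])
        show "s \<in> {0..1}" using s by auto
        fix r :: real assume r: "r \<in> {0..1}" "dist r s < e"
        then have "r \<in> N \<inter> M"
          using e(2) by (auto simp: dist_commute subset_iff)
        then show "F r = (snd c \<circ> \<gamma>) r"
          using N(4) M(2) r(1) by blast
      qed
    qed
  qed
qed

lemma path_has_velocity:
  assumes "smooth_path_within X A S \<gamma>" "c \<in> A" "t \<in> {0..1}" "\<gamma> t \<in> fst c"
  shows "((snd c \<circ> \<gamma>) has_vector_derivative vector_derivative (snd c \<circ> \<gamma>) (at t within {0..1}))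
           (at t within {0..1})"
proof -
  obtain v where "((snd c \<circ> \<gamma>) has_vector_derivative v) (at t within {0..1})"
    using local_velocity[OF assms] assms(3) by (metis IntI)
  then show ?thesis
    by (metis vector_derivative_works differentiableI_vector)
qed

lemma unit_interval_vector_derivative:
  fixes f :: "real \<Rightarrow> 'b::euclidean_space"
  assumes "(f has_vector_derivative v) (at t within {0..1})" "t \<in> {0..1}"
  shows "vector_derivative f (at t within {0..1}) = v"
  using vector_derivative_within_cbox[of 0 1 t f v] assms by simp

text \<open>The chain rule for the transition map and the transformation law of the metric compensate
  each other, so that the arbitrary choice of chart in the speed can be replaced by any chart that
  suits a computation.\<close>

lemma speed_in_chart:
  assumes \<gamma>: "smooth_path_within X A S \<gamma>" and c: "c \<in> A" and t: "t \<in> {0..1}" "\<gamma> t \<in> fst c"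
  shows "speed A g \<gamma> t = sqrt (g c (\<gamma> t) (vector_derivative (snd c \<circ> \<gamma>) (at t within {0..1}))
                                        (vector_derivative (snd c \<circ> \<gamma>) (at t within {0..1})))"
proof -
  define c' where "c' = (SOME c. c \<in> A \<and> \<gamma> t \<in> fst c)"
  have c': "c' \<in> A" "\<gamma> t \<in> fst c'"
    unfolding c'_def using someI[of "\<lambda>c. c \<in> A \<and> \<gamma> t \<in> fst c" c] c t by auto
  let ?v = "vector_derivative (snd c \<circ> \<gamma>) (at t within {0..1})"
  let ?w = "vector_derivative (snd c' \<circ> \<gamma>) (at t within {0..1})"
  let ?D = "frechet_derivative (transition c c') (at (snd c (\<gamma> t)))"
  obtain N where N: "open N" "t \<in> N" "\<And>s. s \<in> N \<inter> {0..1} \<Longrightarrow> \<gamma> s \<in> fst c"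
    using local_velocity[OF \<gamma> c t] by metis
  obtain e where e: "e > 0" "ball t e \<subseteq> N"
    by (rule openE[OF N(1,2)])
  have D: "(transition c c' has_derivative ?D) (at ((snd c \<circ> \<gamma>) t))"
    using transition_differentiable[OF c c'(1) t(2) c'(2)] by (simp only: frechet_derivative_works o_apply)
  have "((transition c c' \<circ> (snd c \<circ> \<gamma>)) has_vector_derivative ?D ?v) (at t within {0..1})"
    by (rule vector_derivative_diff_chain_within[OF path_has_velocity[OF \<gamma> c t] has_derivative_at_withinI[OF D]])
  then have "((snd c' \<circ> \<gamma>) has_vector_derivative ?D ?v) (at t within {0..1})"
  proof (rule has_vector_derivative_transform_within[OF _ e(1) t(1)])
    fix s :: real assume "s \<in> {0..1}" "dist s t < e"
    then have "s \<in> N \<inter> {0..1}"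
      using e(2) by (auto simp: dist_commute subset_iff)
    then show "(transition c c' \<circ> (snd c \<circ> \<gamma>)) s = (snd c' \<circ> \<gamma>) s"
      using N(3) c by (simp add: transition_def)
  qed
  then have "?w = ?D ?v"
    using t(1) by (rule unit_interval_vector_derivative)
  then show ?thesis
    using metric_transform[OF c c'(1), of "\<gamma> t" ?v ?v] t(2) c'(2)
    by (simp add: speed_def c'_def[symmetric] Let_def)
qed

lemma speed_nonneg:
  assumes \<gamma>: "smooth_path_within X A S \<gamma>" and t: "t \<in> {0..1}"
  shows "speed A g \<gamma> t \<ge> 0"
proof -
  obtain c where c: "c \<in> A" "\<gamma> t \<in> fst c"
    using atlas_covers smooth_path_continuous(2)[OF \<gamma>] t by blast
  have "g c (\<gamma> t) v v \<ge> 0" for v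
    using metric_pos[OF c, of v] bilinear_lzero[OF bilinear_metric[OF c]] by (cases "v = 0") auto
  then show ?thesis
    by (simp add: speed_in_chart[OF \<gamma> c(1) t c(2)])
qed

lemma speed_continuous:
  assumes \<gamma>: "smooth_path_within X A S \<gamma>"
  shows "continuous_on {0..1} (speed A g \<gamma>)"
  unfolding continuous_on_eq_continuous_within
proof
  fix t :: real assume t: "t \<in> {0..1}"
  obtain c where c: "c \<in> A" "\<gamma> t \<in> fst c"
    using atlas_covers smooth_path_continuous(2)[OF \<gamma>] t by blast
  obtain N F' where N: "open N" "t \<in> N" "\<And>s. s \<in> N \<inter> {0..1} \<Longrightarrow> \<gamma> s \<in> fst c"
    "\<And>s. s \<in> N \<inter> {0..1} \<Longrightarrow> ((snd c \<circ> \<gamma>) has_vector_derivative F' s) (at s within {0..1})"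
    "continuous_on N F'"
    using local_velocity[OF \<gamma> c(1) t c(2)] by metis
  let ?\<xi> = "snd c \<circ> \<gamma>"
  let ?T = "N \<inter> {0..1}"
  have "continuous_on ?T ?\<xi>"
    unfolding continuous_on_eq_continuous_within
    using N(4) by (meson Int_lower2 continuous_within_subset has_vector_derivative_continuous)
  moreover have "continuous_on ?T F'"
    using N(5) by (auto intro: continuous_on_subset)
  ultimately have "continuous_on ?T (\<lambda>s. sqrt (g c (inv_into (fst c) (snd c) (?\<xi> s)) (F' s) (F' s)))"
    using N(3) by (intro continuous_on_real_sqrt metric_continuous c(1)) auto
  moreover have "sqrt (g c (inv_into (fst c) (snd c) (?\<xi> s)) (F' s) (F' s)) = speed A g \<gamma> s" if s: "s \<in> ?T" for s
  proof -
    have "vector_derivative ?\<xi> (at s within {0..1}) = F' s"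
      using s by (intro unit_interval_vector_derivative N(4)) auto
    then show ?thesis
      using speed_in_chart[OF \<gamma> c(1), of s] N(3)[OF s] s c(1) by simp
  qed
  ultimately have "continuous_on ?T (speed A g \<gamma>)"
    by (rule continuous_on_eq)
  then have "continuous (at t within ?T) (speed A g \<gamma>)"
    using t N(2) by (simp add: continuous_on_eq_continuous_within)
  then show "continuous (at t within {0..1}) (speed A g \<gamma>)"
    using at_within_nhd[OF N(2,1), of "?T" "{0..1}"] by (simp add: Int_commute)
qed

section \<open>Pieces of paths and their lengths\<close>

lemma metric_scaleR:
  assumes "c \<in> A" "p \<in> fst c"
  shows "g c p (k *\<^sub>R v) (k *\<^sub>R v) = k\<^sup>2 * g c p v v"
proof -
  interpret bl: bounded_bilinear "g c p"
    using bilinear_metric[OF assms] by (simp only: bilinear_conv_bounded_bilinear)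
  show ?thesis
    by (simp add: bl.scaleR_left bl.scaleR_right power2_eq_square)
qed

lemma speed_integrable:
  assumes "smooth_path_within X A S \<gamma>" "0 \<le> a" "b \<le> 1"
  shows "speed A g \<gamma> integrable_on {a..b}"
  by (rule integrable_continuous_real, rule continuous_on_subset[OF speed_continuous[OF assms(1)]])
    (use assms in auto)

lemma speed_integral_split:
  assumes "smooth_path_within X A S \<gamma>" "0 \<le> a" "a \<le> b" "b \<le> 1"
  shows "integral {a..b} (speed A g \<gamma>) = integral {0..b} (speed A g \<gamma>) - integral {0..a} (speed A g \<gamma>)"
  using Henstock_Kurzweil_Integration.integral_combine[OF assms(2,3) speed_integrable[OF assms(1) order_refl assms(4)]]
  by simp

lemma speed_integral_nonneg:
  assumes "smooth_path_within X A S \<gamma>" "0 \<le> a" "b \<le> 1"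
  shows "0 \<le> integral {a..b} (speed A g \<gamma>)"
  by (rule integral_nonneg[OF speed_integrable[OF assms]]) (use speed_nonneg[OF assms(1)] assms in auto)

text \<open>Since paths must not be constant, a piece of a path can only be used as a path in its own right
  when it moves; positive length guarantees this.\<close>

lemma constant_piece_has_length_zero:
  assumes \<gamma>: "smooth_path_within X A S \<gamma>" and ab: "0 \<le> a" "a < b" "b \<le> 1"
    and const: "\<And>t. t \<in> {a..b} \<Longrightarrow> \<gamma> t = p"
  shows "integral {a..b} (speed A g \<gamma>) = 0"
proof -
  have "speed A g \<gamma> t = 0" if t: "t \<in> {a..b}" for t
  proof -
    have t01: "t \<in> {0..1}"
      using t ab by auto
    obtain c where c: "c \<in> A" "\<gamma> t \<in> fst c"
      using atlas_covers smooth_path_continuous(2)[OF \<gamma>] t01 by blast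
    let ?v = "vector_derivative (snd c \<circ> \<gamma>) (at t within {0..1})"
    have "((snd c \<circ> \<gamma>) has_vector_derivative ?v) (at t within {a..b})"
      by (rule has_vector_derivative_within_subset[OF path_has_velocity[OF \<gamma> c(1) t01 c(2)]])
        (use ab in auto)
    moreover have "((snd c \<circ> \<gamma>) has_vector_derivative 0) (at t within {a..b})"
      by (rule has_vector_derivative_transform[OF t _ has_vector_derivative_const[of "snd c p"]])
        (simp add: const)
    ultimately have "?v = 0"
      using vector_derivative_unique_within_closed_interval[of a b t "snd c \<circ> \<gamma>" ?v 0] ab(2) t
      by simp
    then show ?thesis
      using bilinear_lzero[OF bilinear_metric[OF c]] by (simp add: speed_in_chart[OF \<gamma> c(1) t01 c(2)])
  qed
  then have "integral {a..b} (speed A g \<gamma>) = integral {a..b} (\<lambda>t. 0)"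
    by (intro integral_cong)
  then show ?thesis by simp
qed

text \<open>The arc length function is an antiderivative of the speed, so the chain rule and the
  fundamental theorem of calculus give the length of the affinely reparametrised piece.\<close>

lemma smooth_path_piece:
  assumes \<gamma>: "smooth_path_within X A S \<gamma>" and ab: "0 \<le> a" "a < b" "b \<le> 1"
    and moves: "0 < integral {a..b} (speed A g \<gamma>)"
  defines "\<delta> \<equiv> \<lambda>u. \<gamma> (a + (b - a) * u)"
  shows "smooth_path_within X A S \<delta>"
    and "riem_length A g \<delta> = integral {a..b} (speed A g \<gamma>)"
proof -
  let ?h = "\<lambda>u. a + (b - a) * u"
  have h01: "?h u \<in> {0..1}" "?h u \<in> {a..b}" if "u \<in> {0..1}" for u :: real
  proof -
    have "0 \<le> (b - a) * u" "(b - a) * u \<le> b - a"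
      using that ab mult_left_mono[of u 1 "b - a"] by auto
    then show "?h u \<in> {0..1}" "?h u \<in> {a..b}"
      unfolding atLeastAtMost_iff using ab by linarith+
  qed
  have "\<not> \<delta> constant_on {0..1}"
  proof
    assume "\<delta> constant_on {0..1}"
    then obtain p where p: "\<And>u. u \<in> {0..1} \<Longrightarrow> \<delta> u = p"
      by (auto simp: constant_on_def)
    have "\<gamma> t = p" if t: "t \<in> {a..b}" for t
    proof -
      have "(t - a) / (b - a) \<in> {0..1}"
        using t ab by (simp add: divide_le_eq)
      moreover have "a + (b - a) * ((t - a) / (b - a)) = t"
        using ab by simp
      ultimately show ?thesis
        using p unfolding \<delta>_def by metis
    qed
    then show False
      using constant_piece_has_length_zero[OF \<gamma> ab] moves by auto
  qed
  moreover have "continuous_map (top_of_set {0..1}) (subtopology X S) \<delta>"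
  proof -
    have "continuous_map (top_of_set {0..1}) (top_of_set {0..1}) ?h"
      using h01(1) by (auto simp: continuous_map_in_subtopology intro!: continuous_intros)
    moreover have "continuous_map (top_of_set {0..1}) (subtopology X S) \<gamma>"
      using \<gamma> by (simp add: smooth_path_within_def path_within_def pathin_def)
    ultimately have "continuous_map (top_of_set {0..1}) (subtopology X S) (\<gamma> \<circ> ?h)"
      by (rule continuous_map_compose)
    then show ?thesis
      by (simp only: \<delta>_def o_def)
  qed
  moreover have "smooth_on {u \<in> {0..1}. \<delta> u \<in> fst c} (snd c \<circ> \<delta>)" if c: "c \<in> A" for c
  proof -
    have "smooth_on {u \<in> {0..1}. \<delta> u \<in> fst c} (\<lambda>u. (snd c \<circ> \<gamma>) (?h u))"
    proof (rule smooth_on_affine_compose)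
      show "smooth_on {t \<in> {0..1}. \<gamma> t \<in> fst c} (snd c \<circ> \<gamma>)"
        using \<gamma> c by (simp add: smooth_path_within_def)
      show "?h u \<in> {t \<in> {0..1}. \<gamma> t \<in> fst c}" if "u \<in> {u \<in> {0..1}. \<delta> u \<in> fst c}" for u
        using that h01(1)[of u] by (simp add: \<delta>_def)
    qed
    then show ?thesis
      by (simp add: o_def \<delta>_def)
  qed
  ultimately show \<delta>: "smooth_path_within X A S \<delta>"
    by (simp add: smooth_path_within_def path_within_def pathin_def)
  have h_deriv: "(?h has_vector_derivative (b - a)) (at u within {0..1})" for u
    by (auto intro!: derivative_eq_intros)
  have speed: "speed A g \<delta> u = (b - a) * speed A g \<gamma> (?h u)" if u: "u \<in> {0..1}" for u
  proof -
    obtain c where c: "c \<in> A" "\<delta> u \<in> fst c"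
      using atlas_covers smooth_path_continuous(2)[OF \<delta>] u by blast
    have c': "\<gamma> (?h u) \<in> fst c"
      using c(2) by (simp add: \<delta>_def)
    let ?v = "vector_derivative (snd c \<circ> \<gamma>) (at (?h u) within {0..1})"
    have "((snd c \<circ> \<gamma>) has_vector_derivative ?v) (at (?h u) within ?h ` {0..1})"
      by (rule has_vector_derivative_within_subset[OF path_has_velocity[OF \<gamma> c(1) h01(1)[OF u] c']])
        (use h01(1) in blast)
    then have "(((snd c \<circ> \<gamma>) \<circ> ?h) has_vector_derivative (b - a) *\<^sub>R ?v) (at u within {0..1})"
      by (rule vector_diff_chain_within[OF h_deriv])
    then have "((snd c \<circ> \<delta>) has_vector_derivative (b - a) *\<^sub>R ?v) (at u within {0..1})"
      by (simp add: o_def \<delta>_def)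
    then have "vector_derivative (snd c \<circ> \<delta>) (at u within {0..1}) = (b - a) *\<^sub>R ?v"
      using u by (rule unit_interval_vector_derivative)
    then have "speed A g \<delta> u = sqrt ((b - a)\<^sup>2 * g c (\<delta> u) ?v ?v)"
      by (simp add: speed_in_chart[OF \<delta> c(1) u c(2)] metric_scaleR[OF c])
    also have "\<dots> = (b - a) * sqrt (g c (\<gamma> (?h u)) ?v ?v)"
      using ab by (simp add: real_sqrt_mult \<delta>_def)
    finally show ?thesis
      by (simp add: speed_in_chart[OF \<gamma> c(1) h01(1)[OF u] c'])
  qed
  let ?l = "\<lambda>t. integral {0..t} (speed A g \<gamma>)"
  have "((?l \<circ> ?h) has_vector_derivative speed A g \<delta> u) (at u within {0..1})" if u: "u \<in> {0..1}" for u
  proof -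
    have "(?l has_vector_derivative speed A g \<gamma> (?h u)) (at (?h u) within {0..1})"
      by (rule integral_has_vector_derivative[OF speed_continuous[OF \<gamma>] h01(1)[OF u]])
    then have "(?l has_vector_derivative speed A g \<gamma> (?h u)) (at (?h u) within ?h ` {0..1})"
      by (rule has_vector_derivative_within_subset) (use h01(1) in blast)
    from vector_diff_chain_within[OF h_deriv this] show ?thesis
      by (simp add: speed[OF u])
  qed
  then have "(speed A g \<delta> has_integral ((?l \<circ> ?h) 1 - (?l \<circ> ?h) 0)) {0..1}"
    by (rule fundamental_theorem_of_calculus[OF zero_le_one])
  then show "riem_length A g \<delta> = integral {a..b} (speed A g \<gamma>)"
    using speed_integral_split[OF \<gamma> ab(1) less_imp_le[OF ab(2)] ab(3)]
    by (simp add: riem_length_def integral_unique)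
qed

section \<open>Short paths stay close to their starting point\<close>

text \<open>Compactness of \<open>K\<close> and of the Euclidean unit sphere bounds the metric from below.\<close>

lemma metric_lower_bound:
  assumes c: "c \<in> A" and K: "compact K" "K \<subseteq> snd c ` fst c"
  obtains m where "m > 0"
    "\<And>q v. q \<in> fst c \<Longrightarrow> snd c q \<in> K \<Longrightarrow> m * norm v \<le> sqrt (g c q v v)"
proof (cases "K = {}")
  case True
  show ?thesis
    by (rule that[of 1]) (use True in auto)
next
  case False
  let ?f = "\<lambda>z. g c (inv_into (fst c) (snd c) (fst z)) (snd z) (snd z)"
  let ?P = "K \<times> (sphere 0 1 :: (real ^ 'n) set)"
  have cont: "continuous_on ?P ?f"
    by (rule metric_continuous[OF c]) (use K in \<open>auto intro!: continuous_intros\<close>)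
  have "compact ?P" "?P \<noteq> {}"
    using K False by (auto intro: compact_Times)
  from continuous_attains_inf[OF this cont]
  obtain z where z: "z \<in> ?P" "\<forall>y\<in>?P. ?f z \<le> ?f y"
    by (elim bexE)
  obtain q0 where q0: "q0 \<in> fst c" "snd c q0 = fst z"
    using z(1) K(2) by (metis imageE mem_Times_iff subsetD)
  have "inv_into (fst c) (snd c) (fst z) = q0"
    using chart_inv_into[OF c q0(1)] q0(2) by simp
  moreover have "snd z \<noteq> 0"
    using z(1) by (metis mem_Times_iff mem_sphere_0 norm_zero zero_neq_one)
  ultimately have pos: "?f z > 0"
    using metric_pos[OF c q0(1)] by simp
  show ?thesis
  proof (rule that[of "sqrt (?f z)"])
    show "sqrt (?f z) > 0"
      using pos by simp
    fix q v assume q: "q \<in> fst c" "snd c q \<in> K"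
    show "sqrt (?f z) * norm v \<le> sqrt (g c q v v)"
    proof (cases "v = 0")
      case False
      let ?u = "(1 / norm v) *\<^sub>R v"
      have v: "v = norm v *\<^sub>R ?u"
        using False by simp
      have "(snd c q, ?u) \<in> ?P"
        using q False by simp
      from bspec[OF z(2) this] have le: "?f z \<le> g c q ?u ?u"
        using c q(1) by (simp only: fst_conv snd_conv chart_inv_into)
      have "g c q v v = (norm v)\<^sup>2 * g c q ?u ?u"
        using metric_scaleR[OF c q(1), of "norm v" ?u] v by simp
      then have "sqrt (g c q v v) = norm v * sqrt (g c q ?u ?u)"
        by (simp add: real_sqrt_mult)
      also have "\<dots> \<ge> norm v * sqrt (?f z)"
        using le by (intro mult_left_mono) auto
      finally show ?thesis
        by (simp add: mult.commute)
    qed (use bilinear_lzero[OF bilinear_metric[OF c q(1)]] in simp)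
  qed
qed

lemma chart_displacement_le_length:
  assumes \<gamma>: "smooth_path_within X A S \<gamma>" and c: "c \<in> A" and t1: "0 \<le> t1" "t1 \<le> 1" and "m > 0"
    and inside: "\<And>t. t \<in> {0..t1} \<Longrightarrow> \<gamma> t \<in> fst c"
    and m: "\<And>t v. t \<in> {0..t1} \<Longrightarrow> m * norm v \<le> sqrt (g c (\<gamma> t) v v)"
  shows "m * norm (snd c (\<gamma> t1) - snd c (\<gamma> 0)) \<le> integral {0..t1} (speed A g \<gamma>)"
proof -
  let ?\<xi> = "snd c \<circ> \<gamma>"
  let ?v = "\<lambda>t. vector_derivative ?\<xi> (at t within {0..1})"
  have sub: "{0..t1} \<subseteq> {0..1}"
    using t1 by auto
  have "(?\<xi> has_vector_derivative ?v t) (at t within {0..t1})" if "t \<in> {0..t1}" for t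
    using has_vector_derivative_within_subset[OF path_has_velocity[OF \<gamma> c subsetD[OF sub that] inside[OF that]] sub] .
  then have int: "(?v has_integral (?\<xi> t1 - ?\<xi> 0)) {0..t1}"
    by (rule fundamental_theorem_of_calculus[OF t1(1)])
  have "norm (integral {0..t1} ?v) \<le> integral {0..t1} (\<lambda>t. speed A g \<gamma> t / m)"
  proof (rule integral_norm_bound_integral)
    show "?v integrable_on {0..t1}"
      using int by (rule has_integral_integrable)
    show "(\<lambda>t. speed A g \<gamma> t / m) integrable_on {0..t1}"
      using speed_integrable[OF \<gamma> order_refl t1(2)] by (rule integrable_on_divide)
    show "norm (?v t) \<le> speed A g \<gamma> t / m" if "t \<in> {0..t1}" for t
      using m[OF that, of "?v t"] speed_in_chart[OF \<gamma> c subsetD[OF sub that] inside[OF that]] \<open>m > 0\<close>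
      by (simp add: pos_le_divide_eq mult.commute)
  qed
  then show ?thesis
    using integral_unique[OF int] \<open>m > 0\<close> by (simp add: field_simps)
qed

text \<open>To leave a chart ball of radius \<open>R\<close> from within its concentric half, a path has to cover the
  Euclidean distance \<open>R / 2\<close> before its first exit, and up to that moment a multiple of the Euclidean
  length bounds the Riemannian one from below.\<close>

lemma short_paths_stay_near:
  assumes W: "openin X W" "p \<in> W"
  obtains V C \<epsilon> where "openin X V" "p \<in> V" "closedin X C" "C \<subseteq> W" "\<epsilon> > 0"
    "\<And>S \<gamma>. smooth_path_within X A S \<gamma> \<Longrightarrow> \<gamma> 0 \<in> V \<Longrightarrow> \<gamma> 1 \<notin> C \<Longrightarrow> \<epsilon> \<le> riem_length A g \<gamma>"
proof -
  obtain c where c: "c \<in> A" "p \<in> fst c"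
    using atlas_covers openin_subset[OF W(1)] W(2) by blast
  have "open (snd c ` (W \<inter> fst c))"
    by (rule open_chart_image[OF c(1) openin_Int[OF W(1) chart_openin[OF c(1)]]]) simp
  moreover have "snd c p \<in> snd c ` (W \<inter> fst c)"
    using c W by blast
  ultimately obtain R where R: "R > 0" "cball (snd c p) R \<subseteq> snd c ` (W \<inter> fst c)"
    using open_contains_cball by metis
  define C where "C = {q \<in> fst c. snd c q \<in> cball (snd c p) R}"
  define O' where "O' = {q \<in> fst c. snd c q \<in> ball (snd c p) R}"
  define V where "V = {q \<in> fst c. snd c q \<in> ball (snd c p) (R / 2)}"
  have C_eq: "C = inv_into (fst c) (snd c) ` cball (snd c p) R"
  proof
    show "C \<subseteq> inv_into (fst c) (snd c) ` cball (snd c p) R"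
    proof
      fix q assume "q \<in> C"
      then have "q = inv_into (fst c) (snd c) (snd c q)" "snd c q \<in> cball (snd c p) R"
        using c(1) by (auto simp: C_def)
      then show "q \<in> inv_into (fst c) (snd c) ` cball (snd c p) R"
        by (rule image_eqI)
    qed
    show "inv_into (fst c) (snd c) ` cball (snd c p) R \<subseteq> C"
      using R(2) c(1) by (auto simp: C_def)
  qed
  have "compactin (top_of_set (snd c ` fst c)) (cball (snd c p) R)"
    using R(2) by (auto simp: compactin_subtopology)
  then have "compactin X C"
    unfolding C_eq by (rule image_compactin[OF _ inverse_chart_continuous[OF c(1)]])
  then have closed: "closedin X C"
    by (rule compactin_imp_closedin[OF Hausdorff])
  have "C \<subseteq> W"
  proof
    fix q assume q: "q \<in> C"
    then obtain q' where "q' \<in> W" "q' \<in> fst c" "snd c q = snd c q'"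
      using R(2) unfolding C_def by blast
    then show "q \<in> W"
      using q inj_onD[OF chart_inj[OF c(1)], of q q'] by (auto simp: C_def)
  qed
  have "cball (snd c p) R \<subseteq> snd c ` fst c"
    using R(2) by blast
  then obtain m where m: "m > 0" "\<And>q v. q \<in> fst c \<Longrightarrow> snd c q \<in> cball (snd c p) R \<Longrightarrow> m * norm v \<le> sqrt (g c q v v)"
    using metric_lower_bound[OF c(1) compact_cball] by metis
  have opnO: "openin X O'" and opnV: "openin X V"
    unfolding O'_def V_def by (rule openin_chart_preimage[OF c(1) open_ball])+
  have "m * (R / 2) \<le> riem_length A g \<gamma>"
    if \<gamma>: "smooth_path_within X A S \<gamma>" and "\<gamma> 0 \<in> V" "\<gamma> 1 \<notin> C" for S \<gamma>
  proof -
    note cont = smooth_path_continuous[OF \<gamma>]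
    define T where "T = {t \<in> {0..1}. \<gamma> t \<in> topspace X - O'}"
    have "closedin X (topspace X - O')"
      using opnO by blast
    then have "closedin (top_of_set {0..1}) T"
      using closedin_continuous_map_preimage[OF cont(1), of "topspace X - O'"] by (simp add: T_def)
    then have "closed T"
      by (rule closedin_closed_trans) simp
    have "1 \<in> T"
      using \<open>\<gamma> 1 \<notin> C\<close> cont(2) by (auto simp: T_def C_def O'_def)
    have "bdd_below T"
      by (rule bdd_belowI[of _ 0]) (simp add: T_def)
    \<comment> \<open>The first exit time from the open chart ball.\<close>
    define t1 where "t1 = Inf T"
    have "t1 \<in> T"
      unfolding t1_def using closed_contains_Inf[of T] \<open>closed T\<close> \<open>1 \<in> T\<close> \<open>bdd_below T\<close> by blast
    have before: "\<gamma> t \<in> O'" if "0 \<le> t" "t < t1" for t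
    proof -
      have "t \<notin> T"
        using that(2) cInf_lower[OF _ \<open>bdd_below T\<close>, of t] by (auto simp: t1_def)
      moreover have t: "t \<in> {0..1}"
        using that \<open>t1 \<in> T\<close> by (simp add: T_def)
      moreover have "\<gamma> t \<in> topspace X"
        using cont(2) t by blast
      ultimately show ?thesis
        unfolding T_def by blast
    qed
    have t1: "0 < t1" "t1 \<le> 1"
    proof -
      have "\<gamma> 0 \<in> O'"
        using \<open>\<gamma> 0 \<in> V\<close> R(1) by (auto simp: V_def O'_def)
      then have "0 \<noteq> t1"
        using \<open>t1 \<in> T\<close> by (auto simp: T_def)
      then show "0 < t1" "t1 \<le> 1"
        using \<open>t1 \<in> T\<close> by (auto simp: T_def)
    qed
    have inC: "\<gamma> t \<in> C" if t: "t \<in> {0..t1}" for t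
    proof -
      have "closedin (top_of_set {0..1}) {t \<in> {0..1}. \<gamma> t \<in> C}"
        using closedin_continuous_map_preimage[OF cont(1) closed] by simp
      then have "closed {t \<in> {0..1}. \<gamma> t \<in> C}"
        by (rule closedin_closed_trans) simp
      moreover have "{0..<t1} \<subseteq> {t \<in> {0..1}. \<gamma> t \<in> C}"
        using before t1 by (auto simp: C_def O'_def less_imp_le)
      ultimately have "closure {0..<t1} \<subseteq> {t \<in> {0..1}. \<gamma> t \<in> C}"
        by (rule closure_minimal[rotated])
      then show ?thesis
        using t t1 by (auto simp: closure_atLeastLessThan)
    qed
    have far: "R \<le> dist (snd c p) (snd c (\<gamma> t1))"
      using inC[of t1] \<open>t1 \<in> T\<close> t1 by (auto simp: T_def O'_def C_def)
    have near: "dist (snd c p) (snd c (\<gamma> 0)) < R / 2"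
      using \<open>\<gamma> 0 \<in> V\<close> by (simp add: V_def)
    have "R / 2 \<le> norm (snd c (\<gamma> t1) - snd c (\<gamma> 0))"
      using far near dist_triangle[of "snd c p" "snd c (\<gamma> t1)" "snd c (\<gamma> 0)"]
      by (simp add: dist_norm norm_minus_commute)
    then have "m * (R / 2) \<le> m * norm (snd c (\<gamma> t1) - snd c (\<gamma> 0))"
      using m(1) by (intro mult_left_mono) auto
    also have "\<dots> \<le> integral {0..t1} (speed A g \<gamma>)"
    proof (rule chart_displacement_le_length[OF \<gamma> c(1) _ t1(2) m(1)])
      show "0 \<le> t1" using t1 by simp
      show "\<gamma> t \<in> fst c" if "t \<in> {0..t1}" for t
        using inC[OF that] by (simp add: C_def)
      show "m * norm v \<le> sqrt (g c (\<gamma> t) v v)" if "t \<in> {0..t1}" for t v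
        using inC[OF that] by (intro m(2)) (simp_all add: C_def)
    qed
    also have "\<dots> \<le> riem_length A g \<gamma>"
      using speed_integral_split[OF \<gamma>, of t1 1] speed_integral_nonneg[OF \<gamma>, of t1 1] t1
      by (simp add: riem_length_def)
    finally show ?thesis .
  qed
  moreover have "p \<in> V" "0 < m * (R / 2)"
    using c(2) R(1) m(1) by (auto simp: V_def)
  ultimately show ?thesis
    using that[OF opnV _ closed \<open>C \<subseteq> W\<close>] by blast
qed

section \<open>Sampling a path by arc length\<close>

lemma path_dist_le_length:
  assumes "smooth_path_within X A S \<gamma>"
  shows "path_dist X A g S (\<gamma> 0) (\<gamma> 1) \<le> ennreal (riem_length A g \<gamma>)"
  unfolding path_dist_def by (rule Inf_lower) (use assms in blast)

lemma path_dist_geI: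
  assumes "\<And>\<gamma>. smooth_path_within X A S \<gamma> \<Longrightarrow> \<gamma> 0 = x \<Longrightarrow> \<gamma> 1 = y \<Longrightarrow> k \<le> ennreal (riem_length A g \<gamma>)"
  shows "k \<le> path_dist X A g S x y"
  unfolding path_dist_def by (rule Inf_greatest) (use assms in blast)

lemma path_dist_less_obtains:
  assumes "path_dist X A g S x y < k"
  obtains \<gamma> where "smooth_path_within X A S \<gamma>" "\<gamma> 0 = x" "\<gamma> 1 = y" "ennreal (riem_length A g \<gamma>) < k"
  using assms unfolding path_dist_def Inf_less_iff by blast

text \<open>The parametrisation by arc length need not be smooth where the speed vanishes, so it is only used
  to pick points on the path; the smooth pieces of the original path between these points have the
  right length. The intermediate value theorem provides the parameters.\<close>

lemma arc_length_sampling: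
  assumes \<gamma>: "smooth_path_within X A S \<gamma>" and pos: "riem_length A g \<gamma> > 0"
  obtains \<sigma> where "\<sigma> 0 = \<gamma> 0" "\<sigma> 1 = \<gamma> 1" "\<And>s. s \<in> {0..1} \<Longrightarrow> \<sigma> s \<in> S"
    "\<And>s t. 0 \<le> s \<Longrightarrow> s < t \<Longrightarrow> t \<le> 1 \<Longrightarrow>
       path_dist X A g S (\<sigma> s) (\<sigma> t) \<le> ennreal ((t - s) * riem_length A g \<gamma>)"
proof -
  define l where "l = (\<lambda>t. integral {0..t} (speed A g \<gamma>))"
  let ?L = "riem_length A g \<gamma>"
  have l0: "l 0 = 0" and l1: "l 1 = ?L"
    by (simp_all add: l_def riem_length_def)
  have l_cont: "continuous_on {0..1} l"
    unfolding l_def by (rule indefinite_integral_continuous_1[OF speed_integrable[OF \<gamma>]]) auto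
  have l_mono: "l a \<le> l b" if "0 \<le> a" "a \<le> b" "b \<le> 1" for a b
    using speed_integral_split[OF \<gamma> that] speed_integral_nonneg[OF \<gamma> that(1,3)] by (simp add: l_def)
  have "\<exists>\<tau>. 0 \<le> \<tau> \<and> \<tau> \<le> 1 \<and> l \<tau> = s * ?L" if s: "s \<in> {0..1}" for s
  proof (rule IVT'[OF _ _ zero_le_one l_cont])
    show "l 0 \<le> s * ?L"
      using s pos by (simp add: l0)
    show "s * ?L \<le> l 1"
      using s pos by (simp add: l1)
  qed
  then obtain \<tau>' where \<tau>': "\<And>s. s \<in> {0..1} \<Longrightarrow> 0 \<le> \<tau>' s \<and> \<tau>' s \<le> 1 \<and> l (\<tau>' s) = s * ?L"
    by metis
  \<comment> \<open>If the path is at rest near an end, \<open>\<tau>'\<close> may miss that end; it is forced to be hit.\<close>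
  define \<tau> where "\<tau> s = (if s = 0 then 0 else if s = 1 then 1 else \<tau>' s)" for s :: real
  have \<tau>: "0 \<le> \<tau> s" "\<tau> s \<le> 1" "l (\<tau> s) = s * ?L" if "s \<in> {0..1}" for s
    using \<tau>'[OF that] by (auto simp: \<tau>_def l0 l1)
  show ?thesis
  proof (rule that[of "\<gamma> \<circ> \<tau>"])
    show "(\<gamma> \<circ> \<tau>) 0 = \<gamma> 0" "(\<gamma> \<circ> \<tau>) 1 = \<gamma> 1"
      by (simp_all add: \<tau>_def)
    show "(\<gamma> \<circ> \<tau>) s \<in> S" if "s \<in> {0..1}" for s
      using smooth_path_continuous(3)[OF \<gamma>, of "\<tau> s"] \<tau>[OF that] by simp
    fix s t :: real assume st: "0 \<le> s" "s < t" "t \<le> 1"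
    then have s: "s \<in> {0..1}" and t: "t \<in> {0..1}"
      by auto
    have "l (\<tau> s) < l (\<tau> t)"
      using st pos \<tau>(3)[OF s] \<tau>(3)[OF t] by simp
    then have less: "\<tau> s < \<tau> t"
      using l_mono[of "\<tau> t" "\<tau> s"] \<tau>[OF s] \<tau>[OF t] by force
    have int: "integral {\<tau> s..\<tau> t} (speed A g \<gamma>) = (t - s) * ?L"
      using speed_integral_split[OF \<gamma> \<tau>(1)[OF s] less_imp_le[OF less] \<tau>(2)[OF t]] \<tau>(3)[OF s] \<tau>(3)[OF t]
      by (simp add: l_def algebra_simps)
    then have "0 < integral {\<tau> s..\<tau> t} (speed A g \<gamma>)"
      using st pos by simp
    note piece = smooth_path_piece[OF \<gamma> \<tau>(1)[OF s] less \<tau>(2)[OF t] this]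
    show "path_dist X A g S ((\<gamma> \<circ> \<tau>) s) ((\<gamma> \<circ> \<tau>) t) \<le> ennreal ((t - s) * ?L)"
      using path_dist_le_length[OF piece(1)] by (simp add: piece(2) int)
  qed
qed

end

section \<open>The intrinsic metric of a submanifold\<close>

text \<open>The interior is a parameter of the locale because it depends on the dimension \<open>'n\<close>, which
  does not occur in its type.\<close>

locale admissible_submanifold = riemannian X A g
  for X :: "'a topology" and A :: "('a, 'n::finite) chart set" and g :: "('a, 'n) metric_field" +
  fixes Y I :: "'a set"
  assumes admissible: "admissible X A g Y"
    and I_eq: "I = intr TYPE('n) X Y"
begin

definition d :: "'a \<Rightarrow> 'a \<Rightarrow> real" where
  "d x y = enn2real (rho_Y X A g Y x y)"

sublocale intrinsic: Metric_space Y d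
  using admissible by (simp add: admissible_def cond_ii_def d_def[abs_def])

lemma Y_subset: "Y \<subseteq> topspace X"
  and compact_Y: "compactin X Y"
  and I_subset: "I \<subseteq> Y"
  using admissible by (auto simp: admissible_def C0_submanifold_def intr_def I_eq)

lemma bdry_subset: "bdry TYPE('n) X Y \<subseteq> Y"
proof
  fix p assume "p \<in> bdry TYPE('n) X Y"
  then obtain c :: "('a, 'n) chart" where "openin (subtopology X Y) (fst c)" "p \<in> fst c"
    by (auto simp: bdry_def mfd_boundary_def half_space_chart_def)
  then show "p \<in> Y"
    using openin_subset by fastforce
qed

lemma rho_eq_d:
  assumes "x \<in> Y" "y \<in> Y"
  shows "rho_Y X A g Y x y = ennreal (d x y)"
  using admissible assms by (simp add: admissible_def cond_i_def d_def)

text \<open>Turns the lower limit in the definition of \<open>rho_Y\<close> into a statement about neighbourhoods.\<close>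

lemma eventually_near_pair:
  assumes "x \<in> Y" "y \<in> Y"
  shows "eventually P (inf (nhdsin X x) (principal I) \<times>\<^sub>F inf (nhdsin X y) (principal I)) \<longleftrightarrow>
    (\<exists>U V. openin X U \<and> x \<in> U \<and> openin X V \<and> y \<in> V \<and> (\<forall>x'\<in>U \<inter> I. \<forall>y'\<in>V \<inter> I. P (x', y')))"
proof -
  have xy: "x \<in> topspace X" "y \<in> topspace X"
    using assms Y_subset by auto
  show ?thesis
  proof
    assume "eventually P (inf (nhdsin X x) (principal I) \<times>\<^sub>F inf (nhdsin X y) (principal I))"
    then obtain Pf Pg where "eventually Pf (inf (nhdsin X x) (principal I))"
      "eventually Pg (inf (nhdsin X y) (principal I))" "\<And>x y. Pf x \<Longrightarrow> Pg y \<Longrightarrow> P (x, y)"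
      unfolding eventually_prod_filter by blast
    then show "\<exists>U V. openin X U \<and> x \<in> U \<and> openin X V \<and> y \<in> V \<and> (\<forall>x'\<in>U \<inter> I. \<forall>y'\<in>V \<inter> I. P (x', y'))"
      using xy unfolding eventually_inf_principal eventually_nhdsin by (metis IntE)
  next
    assume "\<exists>U V. openin X U \<and> x \<in> U \<and> openin X V \<and> y \<in> V \<and> (\<forall>x'\<in>U \<inter> I. \<forall>y'\<in>V \<inter> I. P (x', y'))"
    then obtain U V where "openin X U" "x \<in> U" "openin X V" "y \<in> V" "\<And>x' y'. x' \<in> U \<inter> I \<Longrightarrow> y' \<in> V \<inter> I \<Longrightarrow> P (x', y')"
      by blast
    note UV = this
    have "eventually (\<lambda>z. z \<in> U \<inter> I) (inf (nhdsin X x) (principal I))"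
      using UV(1,2) unfolding eventually_inf_principal eventually_nhdsin by auto
    moreover have "eventually (\<lambda>z. z \<in> V \<inter> I) (inf (nhdsin X y) (principal I))"
      using UV(3,4) unfolding eventually_inf_principal eventually_nhdsin by auto
    ultimately have "eventually (\<lambda>z. fst z \<in> U \<inter> I \<and> snd z \<in> V \<inter> I)
        (inf (nhdsin X x) (principal I) \<times>\<^sub>F inf (nhdsin X y) (principal I))"
      by (rule eventually_prodI)
    then show "eventually P (inf (nhdsin X x) (principal I) \<times>\<^sub>F inf (nhdsin X y) (principal I))"
      by (rule eventually_mono) (metis UV(5) prod.collapse)
  qed
qed

lemma rho_Y_leI:
  assumes "x \<in> Y" "y \<in> Y"
    and "\<And>U V. openin X U \<Longrightarrow> x \<in> U \<Longrightarrow> openin X V \<Longrightarrow> y \<in> V \<Longrightarrow>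
           \<exists>x'\<in>U \<inter> I. \<exists>y'\<in>V \<inter> I. path_dist X A g I x' y' \<le> k"
  shows "rho_Y X A g Y x y \<le> k"
  unfolding rho_Y_def Let_def Liminf_def I_eq[symmetric]
proof (rule SUP_least)
  fix P assume "P \<in> {P. eventually P (inf (nhdsin X x) (principal I) \<times>\<^sub>F inf (nhdsin X y) (principal I))}"
  then obtain U V where UV: "openin X U" "x \<in> U" "openin X V" "y \<in> V" "\<forall>x'\<in>U \<inter> I. \<forall>y'\<in>V \<inter> I. P (x', y')"
    unfolding mem_Collect_eq eventually_near_pair[OF assms(1,2)] by blast
  obtain x' y' where "x' \<in> U \<inter> I" "y' \<in> V \<inter> I" "path_dist X A g I x' y' \<le> k"
    using assms(3)[OF UV(1-4)] by blast
  then show "(INF z\<in>{z. P z}. (\<lambda>(x', y'). path_dist X A g I x' y') z) \<le> k"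
    using UV(5) by (intro INF_lower2[of "(x', y')"]) auto
qed

lemma rho_Y_geI:
  assumes "x \<in> Y" "y \<in> Y" "openin X U" "x \<in> U" "openin X V" "y \<in> V"
    and "\<And>x' y'. x' \<in> U \<inter> I \<Longrightarrow> y' \<in> V \<inter> I \<Longrightarrow> k \<le> path_dist X A g I x' y'"
  shows "k \<le> rho_Y X A g Y x y"
  unfolding rho_Y_def Let_def Liminf_def I_eq[symmetric]
proof (rule SUP_upper2)
  let ?P = "\<lambda>(x', y'). x' \<in> U \<inter> I \<and> y' \<in> V \<inter> I"
  show "?P \<in> {P. eventually P (inf (nhdsin X x) (principal I) \<times>\<^sub>F inf (nhdsin X y) (principal I))}"
    unfolding mem_Collect_eq eventually_near_pair[OF assms(1,2)] using assms(3-6) by blast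
  show "k \<le> (INF z\<in>{z. ?P z}. (\<lambda>(x', y'). path_dist X A g I x' y') z)"
    by (rule INF_greatest) (use assms(7) in auto)
qed

lemma rho_Y_greater_obtains:
  assumes "x \<in> Y" "y \<in> Y" "k < rho_Y X A g Y x y"
  obtains U V where "openin X U" "x \<in> U" "openin X V" "y \<in> V"
    "\<And>x' y'. x' \<in> U \<inter> I \<Longrightarrow> y' \<in> V \<inter> I \<Longrightarrow> k < path_dist X A g I x' y'"
proof -
  have "\<not> (\<forall>U V. openin X U \<and> x \<in> U \<and> openin X V \<and> y \<in> V \<longrightarrow>
      (\<exists>x'\<in>U \<inter> I. \<exists>y'\<in>V \<inter> I. path_dist X A g I x' y' \<le> k))"
    using rho_Y_leI[OF assms(1,2), of k] assms(3) by (metis leD)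
  then show ?thesis
    using that by (meson not_le)
qed

text \<open>The intrinsic metric is at least as fine as the topology of \<open>X\<close>: interior paths that run from near
  \<open>p\<close> to near a point outside \<open>W\<close> have lengths bounded away from \<open>0\<close>, and so does their lower
  limit.\<close>

lemma metric_neighbourhood:
  assumes "p \<in> Y" "openin X W" "p \<in> W"
  obtains \<epsilon> where "\<epsilon> > 0" "\<And>q. q \<in> Y \<Longrightarrow> d p q < \<epsilon> \<Longrightarrow> q \<in> W"
proof -
  obtain V C \<epsilon> where V: "openin X V" "p \<in> V" and C: "closedin X C" "C \<subseteq> W" and "\<epsilon> > 0"
    and exits: "\<And>S \<gamma>. smooth_path_within X A S \<gamma> \<Longrightarrow> \<gamma> 0 \<in> V \<Longrightarrow> \<gamma> 1 \<notin> C \<Longrightarrow> \<epsilon> \<le> riem_length A g \<gamma>"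
    using short_paths_stay_near[OF assms(2,3)] by metis
  show ?thesis
  proof (rule that[OF \<open>\<epsilon> > 0\<close>], rule ccontr)
    fix q assume q: "q \<in> Y" "d p q < \<epsilon>" "q \<notin> W"
    have "ennreal \<epsilon> \<le> rho_Y X A g Y p q"
    proof (rule rho_Y_geI[OF assms(1) q(1) V])
      show "openin X (topspace X - C)"
        using C(1) by blast
      show "q \<in> topspace X - C"
        using q C(2) Y_subset by blast
      fix x' y' assume "x' \<in> V \<inter> I" "y' \<in> (topspace X - C) \<inter> I"
      then show "ennreal \<epsilon> \<le> path_dist X A g I x' y'"
        by (intro path_dist_geI ennreal_leI exits) auto
    qed
    then show False
      using q(2) by (simp add: rho_eq_d[OF assms(1) q(1)])
  qed
qed

text \<open>An upper Lipschitz bound by the distance of the endpoints is all that has to be checked: it makes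
  the path continuous, and a strict inequality anywhere would make the endpoints too close. Limits and
  concatenations are both recognised as shortest paths in this way.\<close>

lemma shortest_pathI:
  assumes xy: "x \<in> Y" "y \<in> Y" "x \<noteq> y" and \<gamma>: "\<And>t. t \<in> {0..1} \<Longrightarrow> \<gamma> t \<in> Y" "\<gamma> 0 = x" "\<gamma> 1 = y"
    and le: "\<And>s t. 0 \<le> s \<Longrightarrow> s < t \<Longrightarrow> t \<le> 1 \<Longrightarrow> d (\<gamma> s) (\<gamma> t) \<le> (t - s) * d x y"
  shows "shortest_path X A g Y x y \<gamma>"
proof -
  have pos: "0 < d x y"
    using intrinsic.mdist_pos_less[of x y] xy by simp
  have lip: "d (\<gamma> s) (\<gamma> t) \<le> \<bar>t - s\<bar> * d x y" if "s \<in> {0..1}" "t \<in> {0..1}" for s t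
  proof -
    consider "s < t" | "s = t" | "t < s" by linarith
    then show ?thesis
    proof cases
      case 1
      then show ?thesis using le[of s t] that by simp
    next
      case 2
      then show ?thesis using \<gamma>(1)[OF that(1)] by simp
    next
      case 3
      then show ?thesis using le[of t s] that intrinsic.commute[of "\<gamma> s" "\<gamma> t"] by simp
    qed
  qed
  have "continuous_map (top_of_set {0..1}) X \<gamma>"
    unfolding continuous_map_def
  proof (intro conjI allI impI)
    show "\<gamma> \<in> topspace (top_of_set {0..1}) \<rightarrow> topspace X"
      using \<gamma>(1) Y_subset by auto
    fix W assume W: "openin X W"
    show "openin (top_of_set {0..1}) {t \<in> topspace (top_of_set {0..1}). \<gamma> t \<in> W}"
      unfolding openin_contains_ball
    proof (intro conjI ballI)
      fix t assume "t \<in> {t \<in> topspace (top_of_set {0..1}). \<gamma> t \<in> W}"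
      then have t: "t \<in> {0..1}" "\<gamma> t \<in> W"
        by auto
      obtain \<epsilon> where \<epsilon>: "\<epsilon> > 0" "\<And>q. q \<in> Y \<Longrightarrow> d (\<gamma> t) q < \<epsilon> \<Longrightarrow> q \<in> W"
        using metric_neighbourhood[OF \<gamma>(1)[OF t(1)] W t(2)] by metis
      have "\<gamma> s \<in> W" if s: "s \<in> {0..1}" "dist t s < \<epsilon> / d x y" for s
      proof (rule \<epsilon>(2)[OF \<gamma>(1)[OF s(1)]])
        have "\<bar>s - t\<bar> * d x y < \<epsilon>"
          using s(2) pos by (simp add: dist_real_def pos_less_divide_eq abs_minus_commute)
        then show "d (\<gamma> t) (\<gamma> s) < \<epsilon>"
          using lip[OF t(1) s(1)] by linarith
      qed
      then show "\<exists>e>0. ball t e \<inter> {0..1} \<subseteq> {t \<in> topspace (top_of_set {0..1}). \<gamma> t \<in> W}"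
        using \<epsilon>(1) pos by (intro exI[of _ "\<epsilon> / d x y"]) auto
    qed auto
  qed
  then have cont: "continuous_map (top_of_set {0..1}) (subtopology X Y) \<gamma>"
    using \<gamma>(1) by (auto simp: continuous_map_in_subtopology)
  have "\<not> \<gamma> constant_on {0..1}"
  proof
    assume "\<gamma> constant_on {0..1}"
    then have "\<gamma> 0 = \<gamma> 1"
      by (auto simp: constant_on_def)
    with \<gamma> xy show False by simp
  qed
  moreover have "rho_Y X A g Y (\<gamma> s) (\<gamma> t) = ennreal (t - s) * rho_Y X A g Y x y"
    if st: "0 \<le> s" "s < t" "t \<le> 1" for s t
  proof -
    have Y: "\<gamma> s \<in> Y" "\<gamma> t \<in> Y"
      using \<gamma>(1) st by auto
    \<comment> \<open>The three consecutive pieces cannot add up to less than the distance of the endpoints.\<close>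
    have "d x y \<le> d x (\<gamma> s) + d (\<gamma> s) (\<gamma> t) + d (\<gamma> t) y"
      using intrinsic.triangle[of x "\<gamma> s" y] intrinsic.triangle[of "\<gamma> s" "\<gamma> t" y] xy Y by simp
    moreover have "d x (\<gamma> s) \<le> s * d x y"
      using lip[of 0 s] st \<gamma>(2) by simp
    moreover have "d (\<gamma> t) y \<le> (1 - t) * d x y"
      using lip[of t 1] st \<gamma>(3) by simp
    ultimately have "(t - s) * d x y \<le> d (\<gamma> s) (\<gamma> t)"
      by (simp add: algebra_simps)
    then have "d (\<gamma> s) (\<gamma> t) = (t - s) * d x y"
      using le[OF st] by simp
    then show ?thesis
      using st by (simp add: rho_eq_d xy Y ennreal_mult)
  qed
  ultimately show ?thesis
    using cont xy \<gamma> by (simp add: shortest_path_def path_within_def pathin_def)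
qed

lemma shortest_path_in_Y:
  assumes "shortest_path X A g Y x y \<gamma>" "t \<in> {0..1}"
  shows "\<gamma> t \<in> Y"
proof -
  have "continuous_map (top_of_set {0..1}) (subtopology X Y) \<gamma>"
    using assms(1) by (simp add: shortest_path_def path_within_def pathin_def)
  then show ?thesis
    using assms(2) by (auto simp: continuous_map_in_subtopology)
qed

lemma shortest_path_d:
  assumes \<gamma>: "shortest_path X A g Y x y \<gamma>" and st: "0 \<le> s" "s \<le> t" "t \<le> 1"
  shows "d (\<gamma> s) (\<gamma> t) = (t - s) * d x y"
proof (cases "s = t")
  case True
  then show ?thesis
    using shortest_path_in_Y[OF \<gamma>, of t] st by simp
next
  case False
  have "rho_Y X A g Y (\<gamma> s) (\<gamma> t) = ennreal (t - s) * rho_Y X A g Y x y"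
    using \<gamma> st False by (simp add: shortest_path_def)
  then show ?thesis
    using st by (simp add: d_def enn2real_mult)
qed

lemma shortest_path_concatenation:
  assumes \<gamma>: "shortest_path X A g Y x z \<gamma>" and \<delta>: "shortest_path X A g Y z y \<delta>"
    and xy: "x \<noteq> y" and add: "d x z + d z y = d x y"
  obtains \<kappa> t where "shortest_path X A g Y x y \<kappa>" "0 < t" "t < 1" "\<kappa> t = z"
proof -
  have ends: "\<gamma> 0 = x" "\<gamma> 1 = z" "\<delta> 0 = z" "\<delta> 1 = y" and neq: "x \<noteq> z" "z \<noteq> y"
    using \<gamma> \<delta> by (auto simp: shortest_path_def)
  have Y: "x \<in> Y" "y \<in> Y" "z \<in> Y"
    using shortest_path_in_Y[OF \<gamma>, of 0] shortest_path_in_Y[OF \<gamma>, of 1]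
      shortest_path_in_Y[OF \<delta>, of 1] ends by auto
  have pos: "0 < d x z" "0 < d z y" "0 < d x y"
    using intrinsic.mdist_pos_less Y neq xy by auto
  \<comment> \<open>The joint is placed where both pieces acquire the same speed.\<close>
  define a where "a = d x z / d x y"
  have a: "0 < a" "a < 1" "d x z = a * d x y" "d z y = (1 - a) * d x y"
    using pos add by (simp_all add: a_def left_diff_distrib)
  define \<kappa> where "\<kappa> t = (if t \<le> a then \<gamma> (t / a) else \<delta> ((t - a) / (1 - a)))" for t
  have left: "0 \<le> t / a" "t / a \<le> 1" if "0 \<le> t" "t \<le> a" for t
    using that a by auto
  have right: "0 \<le> (t - a) / (1 - a)" "(t - a) / (1 - a) \<le> 1" if "a \<le> t" "t \<le> 1" for t
    using that a by (auto simp: divide_le_eq)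
  have d_left: "d (\<kappa> s) (\<kappa> t) = (t - s) * d x y" if "0 \<le> s" "s \<le> t" "t \<le> a" for s t
  proof -
    have "d (\<gamma> (s / a)) (\<gamma> (t / a)) = (t / a - s / a) * d x z"
      using that a left by (intro shortest_path_d[OF \<gamma>]) (auto simp: divide_right_mono)
    also have "t / a - s / a = (t - s) / a"
      by (simp add: diff_divide_distrib)
    finally show ?thesis
      using that a by (simp add: \<kappa>_def)
  qed
  have d_right: "d (\<delta> ((s - a) / (1 - a))) (\<delta> ((t - a) / (1 - a))) = (t - s) * d x y"
    if "a \<le> s" "s \<le> t" "t \<le> 1" for s t
  proof -
    have "d (\<delta> ((s - a) / (1 - a))) (\<delta> ((t - a) / (1 - a))) = ((t - a) / (1 - a) - (s - a) / (1 - a)) * d z y"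
      using that a right by (intro shortest_path_d[OF \<delta>]) (auto simp: divide_right_mono)
    also have "(t - a) / (1 - a) - (s - a) / (1 - a) = (t - s) / (1 - a)"
      by (simp add: diff_divide_distrib)
    finally show ?thesis
      using a by simp
  qed
  have \<kappa>a: "\<kappa> a = z"
    using a by (simp add: \<kappa>_def ends)
  have inY: "\<kappa> t \<in> Y" if "t \<in> {0..1}" for t
    using that left[of t] right[of t] shortest_path_in_Y[OF \<gamma>] shortest_path_in_Y[OF \<delta>]
    by (auto simp: \<kappa>_def)
  have "shortest_path X A g Y x y \<kappa>"
  proof (rule shortest_pathI[OF Y(1,2) xy inY])
    show "\<kappa> 0 = x" "\<kappa> 1 = y"
      using a by (auto simp: \<kappa>_def ends)
    fix s t :: real assume st: "0 \<le> s" "s < t" "t \<le> 1"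
    consider "t \<le> a" | "a < s" | "s \<le> a" "a < t" by linarith
    then show "d (\<kappa> s) (\<kappa> t) \<le> (t - s) * d x y"
    proof cases
      case 1
      then show ?thesis using d_left[of s t] st by simp
    next
      case 2
      then show ?thesis using d_right[of s t] st by (simp add: \<kappa>_def)
    next
      case 3
      have "d (\<kappa> s) (\<kappa> t) \<le> d (\<kappa> s) z + d z (\<kappa> t)"
        using intrinsic.triangle[of "\<kappa> s" z "\<kappa> t"] inY[of s] inY[of t] st Y by simp
      also have "d (\<kappa> s) z = (a - s) * d x y"
        using d_left[of s a] 3 st by (simp add: \<kappa>a)
      also have "d z (\<kappa> t) = (t - a) * d x y"
        using d_right[of a t] 3 st by (simp add: \<kappa>_def ends)
      finally show ?thesis
        by (simp add: algebra_simps)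
    qed
  qed
  then show ?thesis
    using a(1,2) \<kappa>a by (rule that)
qed

end

section \<open>Existence of shortest paths\<close>

text \<open>A filter base on a compact space has a cluster point.\<close>

lemma compact_space_cluster_point:
  assumes Z: "compact_space Z" and ne: "\<F> \<noteq> {}"
    and \<F>: "\<And>K. K \<in> \<F> \<Longrightarrow> K \<noteq> {} \<and> K \<subseteq> topspace Z"
    and directed: "\<And>K L. K \<in> \<F> \<Longrightarrow> L \<in> \<F> \<Longrightarrow> \<exists>M\<in>\<F>. M \<subseteq> K \<inter> L"
  obtains z where "z \<in> topspace Z" "\<And>K U. K \<in> \<F> \<Longrightarrow> openin Z U \<Longrightarrow> z \<in> U \<Longrightarrow> K \<inter> U \<noteq> {}"
proof -
  have finite_lower: "\<exists>M\<in>\<F>. \<forall>K\<in>\<H>. M \<subseteq> K" if "finite \<H>" "\<H> \<subseteq> \<F>" for \<H>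
    using that
  proof (induction \<H>)
    case empty
    then show ?case using ne by auto
  next
    case (insert K \<H>)
    then obtain M where "M \<in> \<F>" "\<forall>L\<in>\<H>. M \<subseteq> L"
      by auto
    then show ?case
      using directed[of K M] insert.prems by (metis insert_iff insert_subset le_inf_iff order_trans)
  qed
  let ?C = "(\<lambda>K. Z closure_of K) ` \<F>"
  have "\<Inter> ?C \<noteq> {}"
  proof (rule Z[unfolded compact_space_fip, rule_format], intro conjI ballI allI impI)
    show "closedin Z C" if "C \<in> ?C" for C
      using that by auto
    fix \<G> assume "finite \<G> \<and> \<G> \<subseteq> ?C"
    then obtain \<H> where \<H>: "\<H> \<subseteq> \<F>" "finite \<H>" "\<G> = (\<lambda>K. Z closure_of K) ` \<H>"
      by (metis finite_subset_image)
    then obtain M where M: "M \<in> \<F>" "\<forall>K\<in>\<H>. M \<subseteq> K"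
      using finite_lower by blast
    have "M \<subseteq> Z closure_of K" if "K \<in> \<H>" for K
      using that M \<F> \<H>(1) closure_of_subset by (metis order_trans subsetD)
    then have "M \<subseteq> \<Inter> \<G>"
      by (auto simp: \<H>(3))
    then show "\<Inter> \<G> \<noteq> {}"
      using \<F>[OF M(1)] by auto
  qed
  then obtain z where z: "\<And>K. K \<in> \<F> \<Longrightarrow> z \<in> Z closure_of K"
    by auto
  show ?thesis
  proof (rule that)
    show "z \<in> topspace Z"
      using z ne by (metis ex_in_conv in_closure_of)
    show "K \<inter> U \<noteq> {}" if "K \<in> \<F>" "openin Z U" "z \<in> U" for K U
      using z[OF that(1)] that(2,3) unfolding in_closure_of by blast
  qed
qed

context admissible_submanifold
begin

text \<open>The approximating families are indexed by neighbourhoods of the endpoints and an excess length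
  \<open>\<eta>\<close>. A cluster point in the topology of pointwise convergence suffices, since the Lipschitz bound
  involves only two parameters at a time and already implies continuity.\<close>

lemma shortest_path_exists:
  assumes xy: "x \<in> Y" "y \<in> Y" "x \<noteq> y"
  obtains \<gamma> where "shortest_path X A g Y x y \<gamma>"
proof -
  define Z where "Z = product_topology (\<lambda>_. subtopology X Y) {0..1::real}"
  have top_Y: "topspace (subtopology X Y) = Y"
    using Y_subset by auto
  have top_Z: "topspace Z = PiE {0..1} (\<lambda>_. Y)"
    by (simp only: Z_def topspace_product_topology top_Y)
  have "compact_space Z"
    unfolding Z_def compact_space_product_topology using compact_space_subtopology[OF compact_Y] by blast
  have eval_open: "openin Z {\<sigma> \<in> topspace Z. \<sigma> s \<in> U}" if "s \<in> {0..1}" "openin X U" for s U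
  proof -
    have "continuous_map Z (subtopology X Y) (\<lambda>\<sigma>. \<sigma> s)"
      unfolding Z_def by (rule continuous_map_product_projection[OF that(1)])
    then have "continuous_map Z X (\<lambda>\<sigma>. \<sigma> s)"
      by (simp add: continuous_map_in_subtopology)
    then show ?thesis
      using that(2) by (rule openin_continuous_map_preimage)
  qed
  have pos: "0 < d x y"
    using intrinsic.mdist_pos_less[of x y] xy by simp
  then have "0 < rho_Y X A g Y x y"
    by (simp add: rho_eq_d xy)
  \<comment> \<open>Near the endpoints, distances in the interior are positive, so the approximating paths have positive
    length and can be sampled by arc length.\<close>
  then obtain U0 V0 where U0: "openin X U0" "x \<in> U0" and V0: "openin X V0" "y \<in> V0"
    and apart: "\<And>x' y'. x' \<in> U0 \<inter> I \<Longrightarrow> y' \<in> V0 \<inter> I \<Longrightarrow> 0 < path_dist X A g I x' y'"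
    using rho_Y_greater_obtains[OF xy(1,2), of 0] by metis
  \<comment> \<open>The bound is the one that arc length sampling gives for a path of length at most \<open>d x y + \<eta>\<close>.\<close>
  define K where "K = (\<lambda>(U, V, \<eta>). {\<sigma> \<in> topspace Z. \<sigma> 0 \<in> U \<and> \<sigma> 1 \<in> V \<and> \<sigma> ` {0..1} \<subseteq> I \<and>
    (\<forall>s t. 0 \<le> s \<and> s < t \<and> t \<le> 1 \<longrightarrow>
       path_dist X A g I (\<sigma> s) (\<sigma> t) \<le> ennreal ((t - s) * (d x y + \<eta>)))})"
  define J where "J = {(U, V, \<eta>::real). openin X U \<and> x \<in> U \<and> openin X V \<and> y \<in> V \<and> \<eta> > 0}"
  have K_nonempty: "K (U, V, \<eta>) \<noteq> {}" if UV: "(U, V, \<eta>) \<in> J" for U V \<eta>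
  proof -
    have UV': "openin X (U \<inter> U0)" "x \<in> U \<inter> U0" "openin X (V \<inter> V0)" "y \<in> V \<inter> V0" and "\<eta> > 0"
      using UV U0 V0 by (auto simp: J_def)
    have "\<not> ennreal (d x y + \<eta>) \<le> rho_Y X A g Y x y"
      using \<open>\<eta> > 0\<close> pos by (simp add: rho_eq_d xy)
    then obtain x' y' where x'y': "x' \<in> (U \<inter> U0) \<inter> I" "y' \<in> (V \<inter> V0) \<inter> I"
      "path_dist X A g I x' y' < ennreal (d x y + \<eta>)"
      using rho_Y_geI[OF xy(1,2) UV'] by (metis not_le)
    then obtain \<gamma> where \<gamma>: "smooth_path_within X A I \<gamma>" "\<gamma> 0 = x'" "\<gamma> 1 = y'"
      "ennreal (riem_length A g \<gamma>) < ennreal (d x y + \<eta>)"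
      using path_dist_less_obtains by metis
    have "0 < path_dist X A g I x' y'"
      using apart x'y' by blast
    also have "\<dots> \<le> ennreal (riem_length A g \<gamma>)"
      using path_dist_le_length[OF \<gamma>(1)] \<gamma>(2,3) by simp
    finally have length_pos: "0 < riem_length A g \<gamma>"
      by simp
    have length_le: "riem_length A g \<gamma> \<le> d x y + \<eta>"
      using \<gamma>(4) length_pos by (simp add: ennreal_less_iff)
    obtain \<sigma> where \<sigma>: "\<sigma> 0 = \<gamma> 0" "\<sigma> 1 = \<gamma> 1" "\<And>s. s \<in> {0..1} \<Longrightarrow> \<sigma> s \<in> I"
      "\<And>s t. 0 \<le> s \<Longrightarrow> s < t \<Longrightarrow> t \<le> 1 \<Longrightarrow>
         path_dist X A g I (\<sigma> s) (\<sigma> t) \<le> ennreal ((t - s) * riem_length A g \<gamma>)"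
      using arc_length_sampling[OF \<gamma>(1) length_pos] by metis
    have bound: "path_dist X A g I (\<sigma> s) (\<sigma> t) \<le> ennreal ((t - s) * (d x y + \<eta>))"
      if st: "0 \<le> s" "s < t" "t \<le> 1" for s t
    proof -
      have "(t - s) * riem_length A g \<gamma> \<le> (t - s) * (d x y + \<eta>)"
        using st length_le by (intro mult_left_mono) auto
      then show ?thesis
        using \<sigma>(4)[OF st] ennreal_leI order_trans by blast
    qed
    have "restrict \<sigma> {0..1} \<in> K (U, V, \<eta>)"
      using \<sigma>(1-3) \<gamma>(2,3) x'y' I_subset bound by (auto simp: K_def top_Z)
    then show ?thesis
      by blast
  qed
  have K_mono: "K (U, V, \<eta>) \<subseteq> K (U', V', \<eta>')"
    if sub: "U \<subseteq> U'" "V \<subseteq> V'" "\<eta> \<le> \<eta>'" for U V \<eta> U' V' \<eta>'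
  proof
    fix \<sigma> assume \<sigma>: "\<sigma> \<in> K (U, V, \<eta>)"
    have "path_dist X A g I (\<sigma> s) (\<sigma> t) \<le> ennreal ((t - s) * (d x y + \<eta>'))"
      if st: "0 \<le> s" "s < t" "t \<le> 1" for s t
    proof -
      have "path_dist X A g I (\<sigma> s) (\<sigma> t) \<le> ennreal ((t - s) * (d x y + \<eta>))"
        using \<sigma> st by (simp add: K_def)
      also have "\<dots> \<le> ennreal ((t - s) * (d x y + \<eta>'))"
        using st sub(3) by (intro ennreal_leI mult_left_mono) auto
      finally show ?thesis .
    qed
    with \<sigma> sub(1,2) show "\<sigma> \<in> K (U', V', \<eta>')"
      by (auto simp: K_def)
  qed
  obtain \<gamma> where \<gamma>: "\<gamma> \<in> topspace Z"
    and cluster: "\<And>L W. L \<in> K ` J \<Longrightarrow> openin Z W \<Longrightarrow> \<gamma> \<in> W \<Longrightarrow> L \<inter> W \<noteq> {}"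
  proof (rule compact_space_cluster_point[OF \<open>compact_space Z\<close>])
    have "(topspace X, topspace X, 1) \<in> J"
      using xy Y_subset by (auto simp: J_def)
    then show "K ` J \<noteq> {}"
      by blast
    show "L \<noteq> {} \<and> L \<subseteq> topspace Z" if L: "L \<in> K ` J" for L
    proof -
      obtain U V \<eta> where "L = K (U, V, \<eta>)" "(U, V, \<eta>) \<in> J"
        using L by auto
      moreover have "K (U, V, \<eta>) \<subseteq> topspace Z"
        by (auto simp: K_def)
      ultimately show ?thesis
        using K_nonempty by simp
    qed
    show "\<exists>M\<in>K ` J. M \<subseteq> L1 \<inter> L2" if L: "L1 \<in> K ` J" "L2 \<in> K ` J" for L1 L2
    proof -
      obtain U1 V1 \<eta>1 U2 V2 \<eta>2 where eq: "L1 = K (U1, V1, \<eta>1)" "L2 = K (U2, V2, \<eta>2)"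
        and J: "(U1, V1, \<eta>1) \<in> J" "(U2, V2, \<eta>2) \<in> J"
        using L by auto
      let ?j = "(U1 \<inter> U2, V1 \<inter> V2, min \<eta>1 \<eta>2)"
      have "?j \<in> J"
        using J by (auto simp: J_def)
      moreover have "K ?j \<subseteq> L1 \<inter> L2"
        unfolding eq by (intro Int_greatest K_mono) auto
      ultimately show ?thesis
        by blast
    qed
  qed (use that in blast)
  have \<gamma>_Y: "\<gamma> t \<in> Y" if "t \<in> {0..1}" for t
    using \<gamma> that by (auto simp: top_Z)
  have meets: "\<exists>\<sigma>\<in>K j. \<sigma> s \<in> U' \<and> \<sigma> t \<in> V'"
    if "j \<in> J" "s \<in> {0..1}" "t \<in> {0..1}" "openin X U'" "openin X V'" "\<gamma> s \<in> U'" "\<gamma> t \<in> V'"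
    for j s t U' V'
  proof -
    have "openin Z ({\<sigma> \<in> topspace Z. \<sigma> s \<in> U'} \<inter> {\<sigma> \<in> topspace Z. \<sigma> t \<in> V'})"
      by (intro openin_Int eval_open that)
    then show ?thesis
      using cluster[OF imageI[OF that(1)]] \<gamma> that(6,7) by blast
  qed
  have end_eq: "\<gamma> s = p"
    if s: "s \<in> {0..1}" and p: "p \<in> Y" and ev: "\<And>U. openin X U \<Longrightarrow> p \<in> U \<Longrightarrow> \<exists>j\<in>J. \<forall>\<sigma>\<in>K j. \<sigma> s \<in> U" for s p
  proof (rule ccontr)
    assume "\<gamma> s \<noteq> p"
    moreover have "p \<in> topspace X" "\<gamma> s \<in> topspace X"
      using p \<gamma>_Y[OF s] Y_subset by blast+
    ultimately obtain U U' where U: "openin X U" "p \<in> U" "openin X U'" "\<gamma> s \<in> U'" "disjnt U U'"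
      using Hausdorff unfolding Hausdorff_space_def by metis
    obtain j where j: "j \<in> J" "\<forall>\<sigma>\<in>K j. \<sigma> s \<in> U"
      using ev[OF U(1,2)] by blast
    obtain \<sigma> where "\<sigma> \<in> K j" "\<sigma> s \<in> U'"
      using meets[OF j(1) s s U(3) U(3) U(4) U(4)] by blast
    then show False
      using j(2) U(5) by (auto simp: disjnt_iff)
  qed
  have X: "openin X (topspace X)" "x \<in> topspace X" "y \<in> topspace X"
    using xy Y_subset by auto
  have "\<gamma> 0 = x"
  proof (rule end_eq[OF _ xy(1)])
    fix U assume "openin X U" "x \<in> U"
    then show "\<exists>j\<in>J. \<forall>\<sigma>\<in>K j. \<sigma> 0 \<in> U"
      using X by (intro bexI[of _ "(U, topspace X, 1)"]) (auto simp: J_def K_def)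
  qed simp
  moreover have "\<gamma> 1 = y"
  proof (rule end_eq[OF _ xy(2)])
    fix V assume "openin X V" "y \<in> V"
    then show "\<exists>j\<in>J. \<forall>\<sigma>\<in>K j. \<sigma> 1 \<in> V"
      using X by (intro bexI[of _ "(topspace X, V, 1)"]) (auto simp: J_def K_def)
  qed simp
  moreover have "d (\<gamma> s) (\<gamma> t) \<le> (t - s) * d x y" if st: "0 \<le> s" "s < t" "t \<le> 1" for s t
  proof (rule field_le_epsilon)
    fix \<eta> :: real assume "\<eta> > 0"
    have s: "s \<in> {0..1}" and t: "t \<in> {0..1}"
      using st by auto
    have "rho_Y X A g Y (\<gamma> s) (\<gamma> t) \<le> ennreal ((t - s) * (d x y + \<eta>))"
    proof (rule rho_Y_leI[OF \<gamma>_Y[OF s] \<gamma>_Y[OF t]])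
      fix U' V' assume "openin X U'" "\<gamma> s \<in> U'" "openin X V'" "\<gamma> t \<in> V'"
      moreover have "(topspace X, topspace X, \<eta>) \<in> J"
        using X \<open>\<eta> > 0\<close> by (simp add: J_def)
      ultimately obtain \<sigma> where \<sigma>: "\<sigma> \<in> K (topspace X, topspace X, \<eta>)" "\<sigma> s \<in> U'" "\<sigma> t \<in> V'"
        using meets s t by blast
      then have "\<sigma> s \<in> I" "\<sigma> t \<in> I" "path_dist X A g I (\<sigma> s) (\<sigma> t) \<le> ennreal ((t - s) * (d x y + \<eta>))"
        using s t st by (auto simp: K_def)
      then show "\<exists>x'\<in>U' \<inter> I. \<exists>y'\<in>V' \<inter> I. path_dist X A g I x' y' \<le> ennreal ((t - s) * (d x y + \<eta>))"
        using \<sigma>(2,3) by blast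
    qed
    then have "d (\<gamma> s) (\<gamma> t) \<le> (t - s) * (d x y + \<eta>)"
      using st pos \<open>\<eta> > 0\<close> by (simp add: rho_eq_d \<gamma>_Y s t)
    also have "\<dots> \<le> (t - s) * d x y + \<eta>"
      using st \<open>\<eta> > 0\<close> mult_right_mono[of "t - s" 1 \<eta>] by (simp add: algebra_simps)
    finally show "d (\<gamma> s) (\<gamma> t) \<le> (t - s) * d x y + \<eta>" .
  qed
  ultimately have "shortest_path X A g Y x y \<gamma>"
    by (intro shortest_pathI xy \<gamma>_Y)
  then show ?thesis
    by (rule that)
qed

section \<open>Strictness of the triangle inequality on the boundary\<close>

text \<open>If the triangle inequality were an equality, two shortest paths joined at \<open>z\<close> would be a shortest
  path that touches the boundary at \<open>z\<close>.\<close>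

lemma circ_property_strict_triangle:
  assumes circ: "circ_property X A g Y"
    and bdry: "x \<in> bdry TYPE('n) X Y" "y \<in> bdry TYPE('n) X Y" "z \<in> bdry TYPE('n) X Y"
    and neq: "x \<noteq> y" "x \<noteq> z" "z \<noteq> y"
  shows "d x y < d x z + d z y"
proof (rule ccontr)
  assume not: "\<not> d x y < d x z + d z y"
  have Y: "x \<in> Y" "y \<in> Y" "z \<in> Y"
    using bdry bdry_subset by auto
  then have add: "d x z + d z y = d x y"
    using not intrinsic.triangle[of x z y] by simp
  obtain \<gamma> \<delta> where "shortest_path X A g Y x z \<gamma>" "shortest_path X A g Y z y \<delta>"
    using shortest_path_exists Y neq by metis
  then obtain \<kappa> t where \<kappa>: "shortest_path X A g Y x y \<kappa>" and t: "0 < t" "t < 1" "\<kappa> t = z"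
    using shortest_path_concatenation[OF _ _ neq(1) add] by metis
  have "\<kappa> ` {0<..<1} \<subseteq> intr TYPE('n) X Y"
    using circ \<kappa> bdry unfolding circ_property_def by blast
  then have "z \<in> intr TYPE('n) X Y"
    using t by (metis greaterThanLessThan_iff image_subset_iff)
  then show False
    using bdry(3) by (simp add: intr_def)
qed

lemma circ_propertyI:
  assumes strict: "\<And>x y z. \<lbrakk>x \<in> bdry TYPE('n) X Y; y \<in> bdry TYPE('n) X Y; z \<in> bdry TYPE('n) X Y;
      x \<noteq> y; x \<noteq> z; z \<noteq> y\<rbrakk> \<Longrightarrow> d x y < d x z + d z y"
  shows "circ_property X A g Y"
  unfolding circ_property_def
proof (intro ballI allI impI subsetI)
  fix x y \<gamma> z
  assume x: "x \<in> bdry TYPE('n) X Y" and y: "y \<in> bdry TYPE('n) X Y"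
    and \<gamma>: "shortest_path X A g Y x y \<gamma>" and "z \<in> \<gamma> ` {0<..<1}"
  then obtain t where t: "0 < t" "t < 1" "z = \<gamma> t"
    by auto
  have ends: "\<gamma> 0 = x" "\<gamma> 1 = y" "x \<noteq> y"
    using \<gamma> by (auto simp: shortest_path_def)
  have Y: "x \<in> Y" "y \<in> Y" "z \<in> Y"
    using x y bdry_subset shortest_path_in_Y[OF \<gamma>, of t] t by auto
  have pos: "0 < d x y"
    using intrinsic.mdist_pos_less[of x y] Y ends by simp
  have dxz: "d x z = t * d x y" and dzy: "d z y = (1 - t) * d x y"
    using shortest_path_d[OF \<gamma>, of 0 t] shortest_path_d[OF \<gamma>, of t 1] t ends by auto
  have "x \<noteq> z" "z \<noteq> y"
    using dxz dzy pos t(1,2) intrinsic.mdist_zero Y by auto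
  moreover have "d x z + d z y = d x y"
    by (simp add: dxz dzy algebra_simps)
  ultimately have "z \<notin> bdry TYPE('n) X Y"
    using strict[OF x y] ends(3) by fastforce
  then show "z \<in> intr TYPE('n) X Y"
    using Y by (simp add: intr_def)
qed

end

section \<open>The rigidity theorem\<close>

theorem theorem3p9:
  fixes X :: "'a topology"
    and A :: "('a, 'n::finite) chart set"
    and g :: "('a, 'n) metric_field"
    and Y1 Y2 :: "'a set"
  assumes "CARD('n) \<ge> 3"
    and "riemannian_manifold X A g"
    and "connected_space X"
    and "admissible X A g Y1"
    and "admissible X A g Y2"
    and "circ_property X A g Y1"
    and "\<forall>Y. admissible X A g Y \<and> circ_property X A g Y \<longrightarrow>
           (\<forall>x\<in>bdry TYPE('n) X Y. \<forall>y\<in>bdry TYPE('n) X Y. rho_X X A g x y = rho_Y X A g Y x y)"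
    and "isometric (bdry TYPE('n) X Y1) (rho_Y X A g Y1) (bdry TYPE('n) X Y2) (rho_Y X A g Y2)"
  shows "isometric (bdry TYPE('n) X Y1) (rho_X X A g) (bdry TYPE('n) X Y2) (rho_X X A g)"
proof -
  interpret Y1: admissible_submanifold X A g Y1 "intr TYPE('n) X Y1"
    by unfold_locales (use assms(2,4) in auto)
  interpret Y2: admissible_submanifold X A g Y2 "intr TYPE('n) X Y2"
    by unfold_locales (use assms(5) in auto)
  let ?B1 = "bdry TYPE('n) X Y1" and ?B2 = "bdry TYPE('n) X Y2"
  obtain f where f: "f ` ?B1 = ?B2"
    and iso: "\<And>x y. x \<in> ?B1 \<Longrightarrow> y \<in> ?B1 \<Longrightarrow> rho_Y X A g Y2 (f x) (f y) = rho_Y X A g Y1 x y"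
    using assms(8) unfolding isometric_def by metis
  have d_iso: "Y2.d (f x) (f y) = Y1.d x y" if "x \<in> ?B1" "y \<in> ?B1" for x y
    using iso[OF that] by (simp add: Y1.d_def Y2.d_def)
  have "circ_property X A g Y2"
  proof (rule Y2.circ_propertyI)
    fix x y z
    assume B2: "x \<in> ?B2" "y \<in> ?B2" "z \<in> ?B2" and neq: "x \<noteq> y" "x \<noteq> z" "z \<noteq> y"
    obtain x' y' z' where B1: "x' \<in> ?B1" "y' \<in> ?B1" "z' \<in> ?B1"
      and eq: "x = f x'" "y = f y'" "z = f z'"
      using B2 unfolding f[symmetric] by (elim imageE)
    have "Y1.d x' y' < Y1.d x' z' + Y1.d z' y'"
      by (rule Y1.circ_property_strict_triangle[OF assms(6) B1]) (use neq eq in auto)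
    then show "Y2.d x y < Y2.d x z + Y2.d z y"
      by (simp add: eq d_iso B1)
  qed
  then have rho2: "rho_X X A g x y = rho_Y X A g Y2 x y" if "x \<in> ?B2" "y \<in> ?B2" for x y
    using assms(5,7) that by blast
  have rho1: "rho_X X A g x y = rho_Y X A g Y1 x y" if "x \<in> ?B1" "y \<in> ?B1" for x y
    using assms(4,6,7) that by blast
  have "rho_X X A g (f x) (f y) = rho_X X A g x y" if "x \<in> ?B1" "y \<in> ?B1" for x y
  proof -
    have "f x \<in> ?B2" "f y \<in> ?B2"
      using f that by auto
    then show ?thesis
      by (simp add: rho1 rho2 iso that)
  qed
  with f show ?thesis
    unfolding isometric_def by blast
qed

end
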